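(* For each $n$ let $X$ be a uniformly distributed $n\times n$ doubly stochastic matrix. Then the mixing time of the Markov chain on $\{1,\dots,n\}$ with transition matrix $X$ is with high probability (that is, with probability tending to $1$ as $n\to\infty$) equal to $2$.
   Context: A doubly stochastic matrix is an $n\times n$ matrix with nonnegative real entries all of whose row sums and column sums equal $1$; the set of these, the Birkhoff polytope, is an $(n-1)^2$-dimensional polytope. "Uniformly distributed" means distributed according to normalized $(n-1)^2$-dimensional Lebesgue measure on this polytope; equivalently, the entries $(X_{ij})_{1\le i,j\le n-1}$ are uniform (normalized Lebesgue measure on $\mathbb{R}^{(n-1)^2}$) on the set of $(n-1)\times(n-1)$ matrices that are the upper-left block of some doubly stochastic $n\times n$ matrix. The stationary distribution of the chain is the uniform distribution on $\{1,\dots,n\}$. The mixing time is the number of steps needed for the chain to be close to stationarity from every starting state, closeness being measured by the total variation distance from stationarity at time $t$, \[ d(t)=\max_{1\le i\le n}\frac12\sum_{j=1}^n\left|\frac1n-(X^t)_{ij}\right| . \] No numerical threshold for $d(t)$ is fixed in the definition of the mixing time. The sense in which the mixing time is $2$ is that at time $2$ one has $P(d(2)>\epsilon)\to 0$ as $n\to\infty$ for every $\epsilon>0$, whereas at time $1$ the rows of $X$ are not close to being constant, so one step does not suffice. *)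

theory Defs
  imports "HOL-Probability.Probability" "Jordan_Normal_Form.Matrix"
begin

definition doubly_stochastic :: "nat \<Rightarrow> real mat \<Rightarrow> bool" where
  "doubly_stochastic n A \<longleftrightarrow>
     A \<in> carrier_mat n n \<and>
     (\<forall>i<n. \<forall>j<n. 0 \<le> A $$ (i, j)) \<and>
     (\<forall>i<n. (\<Sum>j<n. A $$ (i, j)) = 1) \<and>
     (\<forall>j<n. (\<Sum>i<n. A $$ (i, j)) = 1)"

definition corner_index :: "nat \<Rightarrow> (nat \<times> nat) set" where
  "corner_index n = {..<n - 1} \<times> {..<n - 1}"

text \<open>The upper-left \<open>(n-1) \<times> (n-1)\<close> block of a matrix, as a point of the product space over
  \<^term>\<open>corner_index n\<close> (functions that are \<open>undefined\<close> outside the index set).\<close>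

definition corner :: "nat \<Rightarrow> real mat \<Rightarrow> nat \<times> nat \<Rightarrow> real" where
  "corner n A = (\<lambda>ij\<in>corner_index n. A $$ ij)"

definition corner_measure :: "nat \<Rightarrow> (nat \<times> nat \<Rightarrow> real) measure" where
  "corner_measure n = PiM (corner_index n) (\<lambda>_. lborel)"

text \<open>A doubly stochastic matrix is determined by its corner, so the uniform distribution on the
  Birkhoff polytope is specified by the law of the corner: normalized Lebesgue measure on the set of
  corners of doubly stochastic matrices.\<close>

definition uniform_doubly_stochastic :: "nat \<Rightarrow> 'a measure \<Rightarrow> ('a \<Rightarrow> real mat) \<Rightarrow> bool" where
  "uniform_doubly_stochastic n M X \<longleftrightarrow>
     prob_space M \<and>
     (\<forall>\<omega>\<in>space M. doubly_stochastic n (X \<omega>)) \<and>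
     (\<lambda>\<omega>. corner n (X \<omega>)) \<in> measurable M (corner_measure n) \<and>
     distr M (corner_measure n) (\<lambda>\<omega>. corner n (X \<omega>)) =
       uniform_measure (corner_measure n) (corner n ` {A. doubly_stochastic n A})"

text \<open>The states are \<open>{..<n}\<close>. The maximum is meaningful for \<open>n \<ge> 1\<close> only.\<close>

definition tv_from_uniform :: "nat \<Rightarrow> real mat \<Rightarrow> nat \<Rightarrow> real" where
  "tv_from_uniform n A t =
     Max ((\<lambda>i. 1/2 * (\<Sum>j<n. \<bar>1 / real n - (A ^\<^sub>m t) $$ (i, j)\<bar>)) ` {..<n})"

text \<open>The value is \<open>\<infinity>\<close> if the distance never gets down to \<open>\<epsilon>\<close>.\<close>

definition mixing_time :: "nat \<Rightarrow> real mat \<Rightarrow> real \<Rightarrow> enat" where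
  "mixing_time n A \<epsilon> = (INF t\<in>{t. tv_from_uniform n A t \<le> \<epsilon>}. enat t)"

end

theory Submission
  imports Defs "HOL-Real_Asymp.Real_Asymp"
begin

text \<open>
  Fix all rows of the random matrix \<open>X\<close> except two. With \<open>s\<^sub>j\<close> the remaining mass of column
  \<open>j\<close>, the first of the two rows is uniform on the points \<open>x\<close> of the box \<open>\<Prod>[0, s\<^sub>j]\<close>
  with \<open>\<Sum>x\<^sub>j = 1\<close>, which is half the total mass \<open>\<Sum>s\<^sub>j = 2\<close>. Centred at
  \<open>s\<^sub>j/2\<close>, its marginals are even and unimodal and its coordinates are negatively correlated. The
  first fact gives \<open>E X\<^bsub>ij\<^esub>\<^sup>p = O(n\<^sup>-\<^sup>p)\<close>. The second one bounds the rectangle moment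
  \<open>E X\<^bsub>ij\<^esub>X\<^bsub>il\<^esub>X\<^bsub>kj\<^esub>X\<^bsub>kl\<^esub>\<close> by the moment in which one factor is moved to a third row; as rows and
  columns sum to \<open>1\<close>, the latter is at most \<open>n\<^sup>-\<^sup>4(1 + O(1/n))\<close>. Hence the Gram matrix
  \<open>G = X X\<^sup>T\<close> satisfies \<open>E tr G\<^sup>2 \<le> 1 + O(1/n)\<close>, so \<open>G\<close> is close to the constant matrix in
  Hilbert-Schmidt norm, and by Cauchy-Schwarz so are all rows of \<open>X\<^sup>2\<close> in total variation.

  For one step, matrices whose rows are all close to constant lie in an \<open>L\<^sup>1\<close> ball of volume
  \<open>(C \<epsilon>/n)\<close> to the power \<open>(n - 1)\<^sup>2\<close>, while a pigeonhole argument bounds the volume of the polytope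
  from below by \<open>n\<close> to the power \<open>-(n - 1)\<^sup>2 - O(n)\<close>.
\<close>

section \<open>Even unimodal functions\<close>

text \<open>The polytope is handled in corner coordinates, where it is full-dimensional and no
  surface measure is needed. The hyperplane section for the resampled row then becomes a slab: the
  entry in the last column is dropped, and its nonnegativity and that of its partner confine the
  centred sum to a symmetric interval. The crude volume bound suffices because its loss
  \<open>n^O(n)\<close> is beaten by a factor exponential in \<open>n^2\<close>, so no asymptotic
  formula for the volume enters.

  A Hilbert-Schmidt estimate alone does not control every row: a row of \<open>X\<close> minus its
  mean could have norm close to \<open>1\<close>. Hence all entries are bounded by
  \<open>K / n\<close> at once. A union bound over \<open>n^2\<close> entries with
  \<open>p\<close>-th moments needs \<open>K^p\<close> to dominate \<open>n^2\<close>, while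
  Cauchy-Schwarz tolerates only \<open>K^2\<close> of smaller order than \<open>n\<close>. Fourth
  moments just miss; sixth moments leave room for \<open>K = N^(2/5)\<close>, between the exponents
  \<open>1/3\<close> and \<open>1/2\<close>.\<close>

interpretation lborel_PiM: product_sigma_finite "\<lambda>_. lborel :: real measure"
  by standard

text \<open>Evenness is the case of equal absolute values, used in both directions. Values in
  \<open>ennreal\<close> keep integrability questions away.\<close>

definition even_unimodal :: "(real \<Rightarrow> ennreal) \<Rightarrow> bool" where
  "even_unimodal \<phi> \<longleftrightarrow> (\<forall>x y. \<bar>x\<bar> \<le> \<bar>y\<bar> \<longrightarrow> \<phi> y \<le> \<phi> x)"

lemma even_unimodalD: "even_unimodal \<phi> \<Longrightarrow> \<bar>x\<bar> \<le> \<bar>y\<bar> \<Longrightarrow> \<phi> y \<le> \<phi> x"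
  by (simp add: even_unimodal_def)

text \<open>This is \<open>(y - x) * (q - p) >= 0\<close> multiplied out, because subtraction in
  \<open>ennreal\<close> truncates. The window lemma and the negative correlation lemma both
  integrate it pointwise.\<close>

lemma ennreal_rearrangement:
  fixes x y p q :: ennreal
  assumes "x \<le> y" "p \<le> q"
  shows "x * q + y * p \<le> x * p + y * q"
proof -
  obtain d where y: "y = x + d" using assms(1) by (auto simp: le_iff_add)
  have "d * p \<le> d * q" using assms(2) by (rule mult_left_mono) simp
  then show ?thesis unfolding y by (simp add: distrib_right add.assoc add.commute add_left_mono)
qed

lemma nn_integral_lborel_reflect:
  fixes f :: "real \<Rightarrow> ennreal"
  assumes [measurable]: "f \<in> borel_measurable borel"
  shows "(\<integral>\<^sup>+t. f (c - t) \<partial>lborel) = (\<integral>\<^sup>+t. f t \<partial>lborel)"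
  using nn_integral_real_affine[OF assms, of "-1" c] by simp

lemma nn_integral_lborel_translate:
  fixes f :: "real \<Rightarrow> ennreal"
  assumes [measurable]: "f \<in> borel_measurable borel"
  shows "(\<integral>\<^sup>+t. f (c + t) \<partial>lborel) = (\<integral>\<^sup>+t. f t \<partial>lborel)"
  using nn_integral_real_affine[OF assms, of "1" c] by simp

lemma ennreal_le_if_double_le: "2 * a \<le> 2 * b \<Longrightarrow> a \<le> (b::ennreal)"
  by (simp add: ennreal_mult_le_mult_iff)

text \<open>The reflection \<open>t -> x + y - t\<close> exchanges the windows centred at
  \<open>x\<close> and \<open>y\<close>. If \<open>|x| <= |y|\<close> and \<open>x\<close> differs
  from \<open>y\<close>, then in each reflected pair the point nearer to \<open>x\<close> has the
  smaller absolute value, hence the larger value of the function. Rearrangement on such pairs gives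
  the doubled inequality.\<close>

lemma even_unimodal_window:
  assumes [measurable]: "\<phi> \<in> borel_measurable borel" and \<phi>: "even_unimodal \<phi>"
  shows "even_unimodal (\<lambda>v. \<integral>\<^sup>+x. \<phi> (v + (x - s / 2)) * indicator {0..s} x \<partial>lborel)"
proof -
  define h where "h v = (\<integral>\<^sup>+t. \<phi> t * indicator {-(s/2)..s/2} (t - v) \<partial>lborel)" for v
  have h: "(\<integral>\<^sup>+x. \<phi> (v + (x - s / 2)) * indicator {0..s} x \<partial>lborel) = h v" for v
    unfolding h_def
    by (subst (2) nn_integral_lborel_translate[symmetric, where c = "v - s/2"])
       (auto intro!: nn_integral_cong simp: algebra_simps split: split_indicator)
  \<comment> \<open>For \<open>x = y\<close> nearness to \<open>x\<close> and to \<open>y\<close> is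
    always a tie, which says nothing about \<open>|x + y - t|\<close> and \<open>|t|\<close>; that
    case is trivial.\<close>
  have *: "h y \<le> h x" if xy: "\<bar>x\<bar> \<le> \<bar>y\<bar>" "x \<noteq> y" for x y
  proof (rule ennreal_le_if_double_le)
    let ?I = "\<lambda>v t. indicator {-(s/2)..s/2} (t - v) :: ennreal"
    have sw: "(\<integral>\<^sup>+t. \<phi> (x + y - t) * ?I x t \<partial>lborel) = h y"
      "(\<integral>\<^sup>+t. \<phi> (x + y - t) * ?I y t \<partial>lborel) = h x"
      unfolding h_def
      by (subst nn_integral_lborel_reflect[symmetric, where c = "x + y"];
          auto intro!: nn_integral_cong simp: algebra_simps split: split_indicator)+
    have "\<phi> t * ?I y t + \<phi> (x + y - t) * ?I x t \<le> \<phi> (x + y - t) * ?I y t + \<phi> t * ?I x t" for t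
    proof (cases "\<bar>t - y\<bar> \<le> \<bar>t - x\<bar>")
      case True
      then have "\<bar>x + y - t\<bar> \<le> \<bar>t\<bar>" using xy by linarith
      then have a: "\<phi> t \<le> \<phi> (x + y - t)" by (rule even_unimodalD[OF \<phi>])
      have b: "?I x t \<le> ?I y t" using True by (auto split: split_indicator)
      show ?thesis using ennreal_rearrangement[OF a b] by (simp add: add.commute)
    next
      case False
      then have "\<bar>t\<bar> \<le> \<bar>x + y - t\<bar>" using xy by linarith
      then have a: "\<phi> (x + y - t) \<le> \<phi> t" by (rule even_unimodalD[OF \<phi>])
      have b: "?I y t \<le> ?I x t" using False by (auto split: split_indicator)
      show ?thesis using ennreal_rearrangement[OF a b] by (simp add: add.commute)
    qed
    then have "(\<integral>\<^sup>+t. \<phi> t * ?I y t + \<phi> (x + y - t) * ?I x t \<partial>lborel)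
        \<le> (\<integral>\<^sup>+t. \<phi> (x + y - t) * ?I y t + \<phi> t * ?I x t \<partial>lborel)"
      by (intro nn_integral_mono) simp
    then have "h y + h y \<le> h x + h x"
      by (simp add: nn_integral_add sw h_def[symmetric])
    then show "2 * h y \<le> 2 * h x"
      by (simp add: mult_2)
  qed
  show ?thesis unfolding even_unimodal_def h
    using * by (metis order_refl)
qed

text \<open>Up to the product of the \<open>s j\<close>, this is the mean of \<open>u\<close> at
  \<open>v\<close> plus a sum of independent uniform variables on
  \<open>[-s j / 2, s j / 2]\<close>. With \<open>u\<close> the indicator of \<open>{-w..w}\<close>
  it is the volume of a slice of the slab defined below.\<close>

definition box_smoothing :: "'i set \<Rightarrow> ('i \<Rightarrow> real) \<Rightarrow> (real \<Rightarrow> ennreal) \<Rightarrow> real \<Rightarrow> ennreal" where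
  "box_smoothing J s u v = (\<integral>\<^sup>+x. u (v + (\<Sum>j\<in>J. x j - s j / 2)) *
      (\<Prod>j\<in>J. indicator {0..s j} (x j)) \<partial>PiM J (\<lambda>_. lborel))"

lemma box_smoothing_insert:
  assumes J: "finite J" "k \<notin> J" and [measurable]: "u \<in> borel_measurable borel"
  shows "box_smoothing (insert k J) s u v =
    (\<integral>\<^sup>+x. box_smoothing J s u (v + (x - s k / 2)) * indicator {0..s k} x \<partial>lborel)"
proof -
  have "box_smoothing (insert k J) s u v = (\<integral>\<^sup>+t. (\<integral>\<^sup>+x.
     u (v + ((t - s k / 2) + (\<Sum>j\<in>J. x j - s j / 2))) *
      (indicator {0..s k} t * (\<Prod>j\<in>J. indicator {0..s j} (x j))) \<partial>PiM J (\<lambda>_. lborel)) \<partial>lborel)"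
    unfolding box_smoothing_def
    apply (subst lborel_PiM.product_nn_integral_insert_rev[OF J])
     apply measurable
    apply (intro nn_integral_cong)
    using J apply (simp add: if_distrib[of "\<lambda>x. x - _"])
    apply (intro arg_cong2[where f = "(*)"] arg_cong[where f = u] refl prod.cong
        arg_cong2[where f = "(+)"] sum.cong)
      apply auto
    done
  also have "\<dots> = (\<integral>\<^sup>+x. box_smoothing J s u (v + (x - s k / 2)) * indicator {0..s k} x \<partial>lborel)"
    unfolding box_smoothing_def
    by (intro nn_integral_cong, subst nn_integral_multc[symmetric], measurable)
      (auto intro!: nn_integral_cong simp: ac_simps)
  finally show ?thesis .
qed

lemma box_smoothing_measurable [measurable]:
  assumes "finite J" and [measurable]: "u \<in> borel_measurable borel"
  shows "box_smoothing J s u \<in> borel_measurable borel"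
proof -
  interpret sigma_finite_measure "PiM J (\<lambda>_. lborel :: real measure)"
    by (rule lborel_PiM.sigma_finite) fact
  show ?thesis unfolding box_smoothing_def[abs_def] by measurable
qed

lemma even_unimodal_box_smoothing:
  assumes "finite J" and u[measurable]: "u \<in> borel_measurable borel" and "even_unimodal u"
  shows "even_unimodal (box_smoothing J s u)"
  using assms(1)
proof induction
  case empty
  show ?case using assms(3) by (simp add: box_smoothing_def[abs_def] PiM_empty nn_integral_count_space_finite)
next
  case (insert k J)
  have "box_smoothing (insert k J) s u = (\<lambda>v. \<integral>\<^sup>+x. box_smoothing J s u (v + (x - s k / 2)) * indicator {0..s k} x \<partial>lborel)"
    using box_smoothing_insert[OF insert.hyps(1,2) u] by (intro ext)
  then show ?case using even_unimodal_window[OF box_smoothing_measurable[OF insert.hyps(1) u] insert.IH] by simp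
qed

section \<open>Slabs of boxes\<close>

text \<open>The contraction \<open>z = s / 4 + t / 2\<close> towards the centre raises the density
  and keeps \<open>z\<close> at least \<open>t / 2\<close> and \<open>s - z\<close> at least
  \<open>t / 4\<close>. This costs \<open>2 ^ (p + 2)\<close>; the Jacobian \<open>1 / 2\<close>
  gives the last factor 2. The aim is to trade one factor \<open>t\<close> for \<open>s - t\<close>,
  the entry of the same column in the other resampled row.\<close>

lemma unimodal_moment_le:
  fixes s :: real
  assumes [measurable]: "\<psi> \<in> borel_measurable borel" and \<psi>: "even_unimodal \<psi>"
  shows "(\<integral>\<^sup>+t. ennreal (t ^ Suc p) * (indicator {0..s} t * \<psi> (t - s / 2)) \<partial>lborel)
    \<le> 2 ^ (p + 3) * (\<integral>\<^sup>+t. ennreal (t ^ p * (s - t)) * (indicator {0..s} t * \<psi> (t - s / 2)) \<partial>lborel)"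
proof -
  let ?G = "\<lambda>t. ennreal (t ^ p * (s - t)) * (indicator {0..s} t * \<psi> (t - s / 2))"
  have pw: "ennreal (t ^ Suc p) * (indicator {0..s} t * \<psi> (t - s / 2))
      \<le> ennreal (2 ^ (p + 2)) * ?G (s / 4 + (1/2) * t)" for t
  proof (cases "t \<in> {0..s}")
    case True
    define z where "z = s / 4 + (1/2) * t"
    have z: "z \<in> {0..s}" "t / 2 \<le> z" "t / 4 \<le> s - z" using True by (auto simp: z_def)
    have "\<bar>z - s / 2\<bar> \<le> \<bar>t - s / 2\<bar>" by (auto simp: z_def abs_if)
    then have "\<psi> (t - s / 2) \<le> \<psi> (z - s / 2)" by (rule even_unimodalD[OF \<psi>])
    moreover have "t ^ Suc p \<le> 2 ^ (p + 2) * (z ^ p * (s - z))"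
    proof -
      have "(t / 2) ^ p * (t / 4) \<le> z ^ p * (s - z)"
        using z True by (intro mult_mono power_mono) auto
      then show ?thesis by (simp add: power_divide field_simps)
    qed
    ultimately have "ennreal (t ^ Suc p) * \<psi> (t - s / 2) \<le>
        ennreal (2 ^ (p + 2) * (z ^ p * (s - z))) * \<psi> (z - s / 2)"
      by (intro mult_mono ennreal_leI) auto
    then show ?thesis
      unfolding z_def[symmetric] using True z by (simp add: ennreal_mult mult.assoc)
  qed simp
  have "(\<integral>\<^sup>+t. ennreal (t ^ Suc p) * (indicator {0..s} t * \<psi> (t - s / 2)) \<partial>lborel)
      \<le> (\<integral>\<^sup>+t. ennreal (2 ^ (p + 2)) * ?G (s / 4 + (1/2) * t) \<partial>lborel)"
    by (intro nn_integral_mono pw)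
  also have "\<dots> = ennreal (2 ^ (p + 3)) * (ennreal (1/2) * (\<integral>\<^sup>+t. ?G (s / 4 + (1/2) * t) \<partial>lborel))"
  proof -
    have "ennreal (2 ^ (p + 3)) * ennreal (1/2) = ennreal (2 ^ (p + 2))"
      by (subst ennreal_mult[symmetric]) (auto simp: power_add)
    then show ?thesis by (subst nn_integral_cmult) (auto simp: mult.assoc[symmetric])
  qed
  also have "ennreal (1/2) * (\<integral>\<^sup>+t. ?G (s / 4 + (1/2) * t) \<partial>lborel) = (\<integral>\<^sup>+t. ?G t \<partial>lborel)"
    by (subst (2) nn_integral_real_affine[where c = "1/2" and t = "s/4"]) auto
  finally show ?thesis by (simp flip: ennreal_power)
qed

text \<open>With \<open>t\<close> fixed, the reflection \<open>r -> s' - r\<close> exchanges the two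
  weights, whose difference is \<open>4 * (t - s / 2) * (r - s' / 2)\<close>, and turns the sum of
  the centred coordinates inside the density into their difference. Deviations of equal sign make
  the first weight larger and the density at the sum smaller, so rearrangement applies at each
  \<open>r\<close>.\<close>

lemma unimodal_negative_correlation:
  fixes s s' t :: real
  assumes [measurable]: "\<psi> \<in> borel_measurable borel" and \<psi>: "even_unimodal \<psi>"
  shows "(\<integral>\<^sup>+r. ennreal (t * r + (s - t) * (s' - r)) * (indicator {0..s'} r * \<psi> ((t - s / 2) + (r - s' / 2))) \<partial>lborel)
    \<le> (\<integral>\<^sup>+r. ennreal (t * (s' - r) + (s - t) * r) * (indicator {0..s'} r * \<psi> ((t - s / 2) + (r - s' / 2))) \<partial>lborel)"
    (is "?L \<le> ?R")
proof (rule ennreal_le_if_double_le)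
  let ?A = "\<lambda>r. ennreal (t * r + (s - t) * (s' - r))"
  let ?C = "\<lambda>r. ennreal (t * (s' - r) + (s - t) * r)"
  let ?P = "\<lambda>r. \<psi> ((t - s / 2) + (r - s' / 2))" and ?M = "\<lambda>r. \<psi> ((t - s / 2) - (r - s' / 2))"
  have L: "?L = (\<integral>\<^sup>+r. ?C r * (indicator {0..s'} r * ?M r) \<partial>lborel)"
    by (subst nn_integral_lborel_reflect[symmetric, where c = s'])
       (auto intro!: nn_integral_cong arg_cong2[where f = "(*)"] arg_cong[where f = \<psi>] simp: field_simps split: split_indicator)
  have R: "?R = (\<integral>\<^sup>+r. ?A r * (indicator {0..s'} r * ?M r) \<partial>lborel)"
    by (subst nn_integral_lborel_reflect[symmetric, where c = s'])
       (auto intro!: nn_integral_cong arg_cong2[where f = "(*)"] arg_cong[where f = \<psi>] simp: field_simps split: split_indicator)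
  have pw: "?A r * ?P r + ?C r * ?M r \<le> ?A r * ?M r + ?C r * ?P r" for r
  proof -
    have diff: "(t * r + (s - t) * (s' - r)) - (t * (s' - r) + (s - t) * r) = 4 * (t - s / 2) * (r - s' / 2)"
      by (simp add: field_simps)
    consider "(t - s / 2) * (r - s' / 2) \<le> 0" | "(t - s / 2) * (r - s' / 2) \<ge> 0" by linarith
    then show ?thesis
    proof cases
      case 1
      then have "?A r \<le> ?C r" using diff by (intro ennreal_leI) linarith
      moreover have "\<bar>(t - s / 2) + (r - s' / 2)\<bar> \<le> \<bar>(t - s / 2) - (r - s' / 2)\<bar>"
        using 1 by (auto simp: mult_le_0_iff abs_if)
      then have "?M r \<le> ?P r" by (rule even_unimodalD[OF \<psi>])
      ultimately show ?thesis by (rule ennreal_rearrangement)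
    next
      case 2
      then have "?C r \<le> ?A r" using diff by (intro ennreal_leI) linarith
      moreover have "\<bar>(t - s / 2) - (r - s' / 2)\<bar> \<le> \<bar>(t - s / 2) + (r - s' / 2)\<bar>"
        using 2 by (auto simp: zero_le_mult_iff abs_if)
      then have "?P r \<le> ?M r" by (rule even_unimodalD[OF \<psi>])
      ultimately have "?C r * ?M r + ?A r * ?P r \<le> ?C r * ?P r + ?A r * ?M r" by (rule ennreal_rearrangement)
      then show ?thesis by (simp add: add.commute)
    qed
  qed
  have "?L + (\<integral>\<^sup>+r. ?C r * (indicator {0..s'} r * ?M r) \<partial>lborel)
      = (\<integral>\<^sup>+r. (?A r * ?P r + ?C r * ?M r) * indicator {0..s'} r \<partial>lborel)"
    by (subst nn_integral_add[symmetric]) (auto intro!: nn_integral_cong simp: algebra_simps)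
  also have "\<dots> \<le> (\<integral>\<^sup>+r. (?A r * ?M r + ?C r * ?P r) * indicator {0..s'} r \<partial>lborel)"
    by (intro nn_integral_mono mult_right_mono pw) auto
  also have "\<dots> = (\<integral>\<^sup>+r. ?A r * (indicator {0..s'} r * ?M r) \<partial>lborel) + ?R"
    by (subst nn_integral_add[symmetric]) (auto intro!: nn_integral_cong simp: algebra_simps)
  finally show "2 * ?L \<le> 2 * ?R"
    unfolding L[symmetric] R[symmetric] by (simp add: mult_2)
qed

text \<open>Box and sum constraint are both symmetric about the centre \<open>s / 2\<close>. This is
  the fibre of the polytope over the rows that are kept, see
  \<open>merge_row_mem_birkhoff\<close>.\<close>

definition slab :: "'i set \<Rightarrow> ('i \<Rightarrow> real) \<Rightarrow> real \<Rightarrow> ('i \<Rightarrow> real) set" where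
  "slab I s w = {y. (\<forall>i\<in>I. 0 \<le> y i \<and> y i \<le> s i) \<and> \<bar>\<Sum>i\<in>I. y i - s i / 2\<bar> \<le> w}"

lemma indicator_slab:
  assumes "finite I"
  shows "indicator (slab I s w) y =
    indicator {-w..w} (\<Sum>i\<in>I. y i - s i / 2) * (\<Prod>i\<in>I. indicator {0..s i} (y i) :: ennreal)"
proof (cases "\<forall>i\<in>I. 0 \<le> y i \<and> y i \<le> s i")
  case True
  then have "(\<Prod>i\<in>I. indicator {0..s i} (y i) :: ennreal) = 1" by (intro prod.neutral) auto
  then show ?thesis using True by (auto simp: slab_def abs_le_iff split: split_indicator)
next
  case False
  then have "(\<Prod>i\<in>I. indicator {0..s i} (y i) :: ennreal) = 0"
    using assms by (auto simp: prod_zero_iff split: split_indicator)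
  then show ?thesis using False by (auto simp: slab_def split: split_indicator)
qed

lemma measurable_indicator_slab [measurable]:
  assumes "finite I"
  shows "(\<lambda>y. indicator (slab I s w) y :: ennreal) \<in> borel_measurable (PiM I (\<lambda>_. lborel))"
  unfolding indicator_slab[OF assms] by measurable

text \<open>The factor next to \<open>g\<close> is the unnormalized marginal density: the indicator
  of one side of the box times a function of the centred coordinate that is even and unimodal by
  \<open>even_unimodal_box_smoothing\<close>.\<close>

lemma nn_integral_slab_marginal:
  fixes g :: "real \<Rightarrow> ennreal"
  assumes J: "finite J" "e \<notin> J" and [measurable]: "g \<in> borel_measurable borel"
  shows "(\<integral>\<^sup>+y. g (y e) * indicator (slab (insert e J) s w) y \<partial>PiM (insert e J) (\<lambda>_. lborel)) =
    (\<integral>\<^sup>+t. g t * (indicator {0..s e} t * box_smoothing J s (indicator {-w..w}) (t - s e / 2)) \<partial>lborel)"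
proof -
  note [measurable] = measurable_indicator_slab[OF finite.insertI[OF J(1)]]
  have eq: "indicator (slab (insert e J) s w) (x(e := t)) = indicator {0..s e} t *
      (indicator {-w..w} ((t - s e / 2) + (\<Sum>j\<in>J. x j - s j / 2)) *
      (\<Prod>j\<in>J. indicator {0..s j} (x j)) :: ennreal)" for x t
  proof -
    have "(\<Sum>j\<in>J. (x(e := t)) j - s j / 2) = (\<Sum>j\<in>J. x j - s j / 2)"
      "(\<Prod>j\<in>J. indicator {0..s j} ((x(e := t)) j)) = (\<Prod>j\<in>J. indicator {0..s j} (x j) :: ennreal)"
      using J by (auto intro!: sum.cong prod.cong)
    then show ?thesis
      using J by (simp add: indicator_slab ac_simps)
  qed
  have "(\<integral>\<^sup>+y. g (y e) * indicator (slab (insert e J) s w) y \<partial>PiM (insert e J) (\<lambda>_. lborel)) =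
      (\<integral>\<^sup>+t. (\<integral>\<^sup>+x. g t * (indicator {0..s e} t * (indicator {-w..w} ((t - s e / 2) + (\<Sum>j\<in>J. x j - s j / 2)) *
      (\<Prod>j\<in>J. indicator {0..s j} (x j)))) \<partial>PiM J (\<lambda>_. lborel)) \<partial>lborel)"
    by (subst lborel_PiM.product_nn_integral_insert_rev[OF J], measurable) (simp only: eq fun_upd_same)
  also have "\<dots> = (\<integral>\<^sup>+t. g t * (indicator {0..s e} t * box_smoothing J s (indicator {-w..w}) (t - s e / 2)) \<partial>lborel)"
    unfolding box_smoothing_def
    by (intro nn_integral_cong, subst nn_integral_cmult, (use J in measurable)[1], subst nn_integral_cmult, measurable)
  finally show ?thesis .
qed

text \<open>Inside the rectangle the joint density of two coordinates depends only on the sum of the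
  centred coordinates, so a single even unimodal function governs both.\<close>

lemma nn_integral_slab_marginal2:
  fixes g :: "real \<Rightarrow> real \<Rightarrow> ennreal"
  assumes J: "finite J" "e \<notin> J" "f \<notin> J" "e \<noteq> f"
    and [measurable]: "case_prod g \<in> borel_measurable (borel \<Otimes>\<^sub>M borel)"
  shows "(\<integral>\<^sup>+y. g (y e) (y f) * indicator (slab (insert e (insert f J)) s w) y
      \<partial>PiM (insert e (insert f J)) (\<lambda>_. lborel)) =
    (\<integral>\<^sup>+t. indicator {0..s e} t * (\<integral>\<^sup>+r. g t r * (indicator {0..s f} r *
      box_smoothing J s (indicator {-w..w}) ((t - s e / 2) + (r - s f / 2))) \<partial>lborel) \<partial>lborel)"
proof -
  note [measurable] = measurable_indicator_slab[OF finite.insertI[OF finite.insertI[OF J(1)]]]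
  have eq: "indicator (slab (insert e (insert f J)) s w) ((x(f := r))(e := t)) = indicator {0..s e} t * (indicator {0..s f} r *
      (indicator {-w..w} ((t - s e / 2) + (r - s f / 2) + (\<Sum>j\<in>J. x j - s j / 2)) *
      (\<Prod>j\<in>J. indicator {0..s j} (x j))) :: ennreal)" for x t r
  proof -
    let ?x = "(x(f := r))(e := t)"
    have "(\<Sum>j\<in>J. ?x j - s j / 2) = (\<Sum>j\<in>J. x j - s j / 2)"
      "(\<Prod>j\<in>J. indicator {0..s j} (?x j)) = (\<Prod>j\<in>J. indicator {0..s j} (x j) :: ennreal)"
      using J by (auto intro!: sum.cong prod.cong)
    then show ?thesis
      using J by (simp add: indicator_slab ac_simps del: fun_upd_apply) (simp add: ac_simps)
  qed
  have "(\<integral>\<^sup>+y. g (y e) (y f) * indicator (slab (insert e (insert f J)) s w) y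
      \<partial>PiM (insert e (insert f J)) (\<lambda>_. lborel)) =
      (\<integral>\<^sup>+t. (\<integral>\<^sup>+x. g t (x f) * indicator (slab (insert e (insert f J)) s w) (x(e := t)) \<partial>PiM (insert f J) (\<lambda>_. lborel)) \<partial>lborel)"
    using J by (subst lborel_PiM.product_nn_integral_insert_rev) (auto intro!: nn_integral_cong)
  also have "\<dots> = (\<integral>\<^sup>+t. (\<integral>\<^sup>+r. (\<integral>\<^sup>+x. g t r * (indicator {0..s e} t * (indicator {0..s f} r *
      (indicator {-w..w} ((t - s e / 2) + (r - s f / 2) + (\<Sum>j\<in>J. x j - s j / 2)) *
      (\<Prod>j\<in>J. indicator {0..s j} (x j))))) \<partial>PiM J (\<lambda>_. lborel)) \<partial>lborel) \<partial>lborel)"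
    using J
    by (intro nn_integral_cong, subst lborel_PiM.product_nn_integral_insert_rev, simp, simp)
      (auto simp only: eq fun_upd_same intro!: measurable_fun_upd[where J = "insert f J"], measurable)
  also have "\<dots> = (\<integral>\<^sup>+t. (\<integral>\<^sup>+r. indicator {0..s e} t * (g t r * (indicator {0..s f} r *
      box_smoothing J s (indicator {-w..w}) ((t - s e / 2) + (r - s f / 2)))) \<partial>lborel) \<partial>lborel)"
    unfolding box_smoothing_def using J(1)
    by (intro nn_integral_cong) (simp add: nn_integral_cmult ac_simps)
  also have "\<dots> = (\<integral>\<^sup>+t. indicator {0..s e} t * (\<integral>\<^sup>+r. g t r * (indicator {0..s f} r *
      box_smoothing J s (indicator {-w..w}) ((t - s e / 2) + (r - s f / 2))) \<partial>lborel) \<partial>lborel)"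
    using J(1) by (intro nn_integral_cong nn_integral_cmult) measurable
  finally show ?thesis .
qed

lemma even_unimodal_indicator: "even_unimodal (indicator {-w..w})"
  unfolding even_unimodal_def by (auto split: split_indicator)

lemma slab_moment_le:
  assumes "finite I" "e \<in> I"
  shows "(\<integral>\<^sup>+y. ennreal (y e ^ Suc p) * indicator (slab I s w) y \<partial>PiM I (\<lambda>_. lborel))
    \<le> 2 ^ (p + 3) * (\<integral>\<^sup>+y. ennreal (y e ^ p * (s e - y e)) * indicator (slab I s w) y \<partial>PiM I (\<lambda>_. lborel))"
proof -
  define J where "J = I - {e}"
  have I: "I = insert e J" and J: "finite J" "e \<notin> J" using assms by (auto simp: J_def)
  show ?thesis unfolding I
    by (subst (1 2) nn_integral_slab_marginal[OF J, where g = "\<lambda>t. ennreal (_ t)"]; measurable?)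
      (intro unimodal_moment_le even_unimodal_box_smoothing box_smoothing_measurable even_unimodal_indicator J(1) borel_measurable_indicator; simp)
qed

lemma slab_negative_correlation:
  assumes "finite I" "e \<in> I" "f \<in> I" "e \<noteq> f"
  shows "(\<integral>\<^sup>+y. ennreal (y e * y f + (s e - y e) * (s f - y f)) * indicator (slab I s w) y \<partial>PiM I (\<lambda>_. lborel))
    \<le> (\<integral>\<^sup>+y. ennreal (y e * (s f - y f) + (s e - y e) * y f) * indicator (slab I s w) y \<partial>PiM I (\<lambda>_. lborel))"
proof -
  define J where "J = I - {e, f}"
  have I: "I = insert e (insert f J)" and J: "finite J" "e \<notin> J" "f \<notin> J" using assms by (auto simp: J_def)
  show ?thesis unfolding I
    apply (subst (1 2) nn_integral_slab_marginal2[OF J assms(4), where g = "\<lambda>t r. ennreal (_ t r)"])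
      apply measurable
    apply (rule nn_integral_mono, rule mult_left_mono, rule unimodal_negative_correlation)
    using J(1) apply (auto intro!: even_unimodal_box_smoothing box_smoothing_measurable even_unimodal_indicator)
    done
qed

section \<open>Measure-preserving maps of product Lebesgue measure\<close>

lemma distr_PiM_lborel_affine:
  fixes c :: "'i \<Rightarrow> real" and \<sigma> :: real
  assumes I: "finite I" and \<sigma>: "\<bar>\<sigma>\<bar> = 1"
  shows "distr (PiM I (\<lambda>_. lborel)) (PiM I (\<lambda>_. lborel)) (\<lambda>x. \<lambda>i\<in>I. c i + \<sigma> * x i) = PiM I (\<lambda>_. lborel)"
proof (rule lborel_PiM.PiM_eqI[OF I])
  fix A :: "'i \<Rightarrow> real set" assume A: "\<And>i. i \<in> I \<Longrightarrow> A i \<in> sets lborel"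
  have pre: "(\<lambda>t. c i + \<sigma> * t) -` A i \<in> sets lborel" if "i \<in> I" for i
    using measurable_sets[of "\<lambda>t. c i + \<sigma> * t" lborel lborel "A i"] A[OF that] by simp
  have "emeasure (distr (PiM I (\<lambda>_. lborel)) (PiM I (\<lambda>_. lborel)) (\<lambda>x. \<lambda>i\<in>I. c i + \<sigma> * x i)) (Pi\<^sub>E I A)
      = emeasure (PiM I (\<lambda>_. lborel)) (Pi\<^sub>E I (\<lambda>i. (\<lambda>t. c i + \<sigma> * t) -` A i))"
    using A I by (subst emeasure_distr)
      (auto intro!: arg_cong[where f = "emeasure _"] sets_PiM_I_finite simp: space_PiM PiE_iff Pi_iff)
  also have "\<dots> = (\<Prod>i\<in>I. emeasure lborel ((\<lambda>t. c i + \<sigma> * t) -` A i))"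
    by (rule lborel_PiM.emeasure_PiM[OF I pre])
  also have "\<dots> = (\<Prod>i\<in>I. emeasure lborel (A i))"
  proof (rule prod.cong)
    fix i assume i: "i \<in> I"
    have "lborel = distr lborel borel (\<lambda>t. c i + \<sigma> * t)"
      using lborel_real_affine[of \<sigma> "c i"] \<sigma> by (auto simp: density_1)
    then have "emeasure lborel (A i) = emeasure (distr lborel borel (\<lambda>t. c i + \<sigma> * t)) (A i)" by simp
    also have "\<dots> = emeasure lborel ((\<lambda>t. c i + \<sigma> * t) -` A i)"
      using A[OF i] by (subst emeasure_distr) auto
    finally show "emeasure lborel ((\<lambda>t. c i + \<sigma> * t) -` A i) = emeasure lborel (A i)" by simp
  qed simp
  finally show "emeasure (distr (PiM I (\<lambda>_. lborel)) (PiM I (\<lambda>_. lborel)) (\<lambda>x. \<lambda>i\<in>I. c i + \<sigma> * x i)) (Pi\<^sub>E I A)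
      = (\<Prod>i\<in>I. emeasure lborel (A i))" .
qed simp

lemma distr_PiM_lborel_shear:
  fixes b :: "'i \<Rightarrow> ('i \<Rightarrow> real) \<Rightarrow> real" and \<sigma> :: real
  assumes I: "finite I" and S: "S \<subseteq> I" and \<sigma>: "\<bar>\<sigma>\<bar> = 1"
    and b[measurable]: "\<And>i. i \<in> S \<Longrightarrow> b i \<in> borel_measurable (PiM I (\<lambda>_. lborel))"
    and b_cong: "\<And>i x y. i \<in> S \<Longrightarrow> (\<And>j. j \<in> I - S \<Longrightarrow> x j = y j) \<Longrightarrow> b i x = b i y"
  shows "distr (PiM I (\<lambda>_. lborel)) (PiM I (\<lambda>_. lborel))
     (\<lambda>x. \<lambda>i\<in>I. if i \<in> S then b i x + \<sigma> * x i else x i) = PiM I (\<lambda>_. lborel)"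
proof -
  define T where "T = (\<lambda>x. \<lambda>i\<in>I. if i \<in> S then b i x + \<sigma> * x i else x i)"
  let ?M = "\<lambda>I. PiM I (\<lambda>_. lborel :: real measure)"
  have T[measurable]: "T \<in> measurable (?M I) (?M I)"
    unfolding T_def
  proof (rule measurable_restrict)
    fix i assume "i \<in> I"
    then show "(\<lambda>x. if i \<in> S then b i x + \<sigma> * x i else x i) \<in> measurable (?M I) lborel"
      by (cases "i \<in> S") auto
  qed
  have fold: "(\<integral>\<^sup>+x. f x \<partial>?M I) = (\<integral>\<^sup>+r. (\<integral>\<^sup>+y. f (merge (I - S) S (r, y)) \<partial>?M S) \<partial>?M (I - S))"
    if [measurable]: "f \<in> borel_measurable (?M I)" for f
  proof -
    have "I = (I - S) \<union> S" using S by auto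
    then show ?thesis
      using I S that lborel_PiM.product_nn_integral_fold[of "I - S" S f] finite_subset[OF S] by auto
  qed
  have inner: "(\<integral>\<^sup>+y. f (T (merge (I - S) S (r, y))) \<partial>?M S) = (\<integral>\<^sup>+y. f (merge (I - S) S (r, y)) \<partial>?M S)"
    if [measurable]: "f \<in> borel_measurable (?M I)" and r: "r \<in> space (?M (I - S))" for f r
  proof -
    \<comment> \<open>\<open>b i\<close> reads only coordinates outside \<open>S\<close>, so the
      value \<open>0\<close> filled in on \<open>S\<close> is arbitrary.\<close>
    define c where "c i = b i (merge (I - S) S (r, \<lambda>_. 0))" for i
    have "T (merge (I - S) S (r, y)) = merge (I - S) S (r, \<lambda>i\<in>S. c i + \<sigma> * y i)" for y
    proof
      fix i
      have "b i (merge (I - S) S (r, y)) = c i" if "i \<in> S" for i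
        unfolding c_def using that by (intro b_cong) auto
      then show "T (merge (I - S) S (r, y)) i = merge (I - S) S (r, \<lambda>i\<in>S. c i + \<sigma> * y i) i"
        using S by (auto simp: T_def merge_def)
    qed
    then have "(\<integral>\<^sup>+y. f (T (merge (I - S) S (r, y))) \<partial>?M S)
        = (\<integral>\<^sup>+y. f (merge (I - S) S (r, \<lambda>i\<in>S. c i + \<sigma> * y i)) \<partial>?M S)" by simp
    also have "\<dots> = (\<integral>\<^sup>+y. f (merge (I - S) S (r, y)) \<partial>distr (?M S) (?M S) (\<lambda>y. \<lambda>i\<in>S. c i + \<sigma> * y i))"
    proof (rule nn_integral_distr[symmetric])
      have "I = (I - S) \<union> S" using S by auto
      then have "f \<in> borel_measurable (?M ((I - S) \<union> S))" using that by simp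
      moreover have "(\<lambda>y. merge (I - S) S (r, y)) \<in> measurable (?M S) (?M ((I - S) \<union> S))"
        using r by (intro measurable_compose[OF measurable_Pair measurable_merge]) auto
      ultimately show "(\<lambda>y. f (merge (I - S) S (r, y))) \<in> borel_measurable (distr (?M S) (?M S) (\<lambda>y. \<lambda>i\<in>S. c i + \<sigma> * y i))"
        by (simp add: measurable_compose[rotated])
      show "(\<lambda>y. \<lambda>i\<in>S. c i + \<sigma> * y i) \<in> measurable (?M S) (?M S)"
        by (rule measurable_restrict) auto
    qed
    also have "distr (?M S) (?M S) (\<lambda>y. \<lambda>i\<in>S. c i + \<sigma> * y i) = ?M S"
      by (rule distr_PiM_lborel_affine[OF finite_subset[OF S I] \<sigma>])
    finally show ?thesis .
  qed
  have "distr (?M I) (?M I) T = ?M I"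
  proof (rule measure_eqI)
    fix A assume "A \<in> sets (distr (?M I) (?M I) T)"
    then have [measurable]: "A \<in> sets (?M I)" by simp
    have "emeasure (distr (?M I) (?M I) T) A = (\<integral>\<^sup>+x. indicator A x \<partial>distr (?M I) (?M I) T)"
      by (subst nn_integral_indicator) auto
    also have "\<dots> = (\<integral>\<^sup>+x. indicator A (T x) \<partial>?M I)"
      by (rule nn_integral_distr) auto
    also have "\<dots> = (\<integral>\<^sup>+x. indicator A x \<partial>?M I)"
    proof -
      have "(\<integral>\<^sup>+x. indicator A (T x) \<partial>?M I)
          = (\<integral>\<^sup>+r. (\<integral>\<^sup>+y. indicator A (T (merge (I - S) S (r, y))) \<partial>?M S) \<partial>?M (I - S))"
        by (rule fold) measurable
      also have "\<dots> = (\<integral>\<^sup>+r. (\<integral>\<^sup>+y. indicator A (merge (I - S) S (r, y)) \<partial>?M S) \<partial>?M (I - S))"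
        by (rule nn_integral_cong, rule inner[of "indicator A"]) auto
      also have "\<dots> = (\<integral>\<^sup>+x. indicator A x \<partial>?M I)"
        by (rule fold[symmetric]) measurable
      finally show ?thesis .
    qed
    finally show "emeasure (distr (?M I) (?M I) T) A = emeasure (?M I) A" by simp
  qed simp
  then show ?thesis by (simp add: T_def)
qed

lemma distr_PiM_lborel_translate:
  fixes c :: "'i \<Rightarrow> real"
  assumes "finite I"
  shows "distr (PiM I (\<lambda>_. lborel)) (PiM I (\<lambda>_. lborel)) (\<lambda>x. \<lambda>i\<in>I. c i + x i) = PiM I (\<lambda>_. lborel)"
  using distr_PiM_lborel_affine[OF assms, of 1 c] by simp

lemma distr_PiM_lborel_transpose:
  assumes A: "finite A"
  shows "distr (PiM (A \<times> A) (\<lambda>_. lborel)) (PiM (A \<times> A) (\<lambda>_. lborel))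
     (\<lambda>x. \<lambda>p\<in>A \<times> A. x (snd p, fst p)) = PiM (A \<times> A) (\<lambda>_. lborel :: real measure)"
proof (rule lborel_PiM.PiM_eqI)
  fix E :: "'a \<times> 'a \<Rightarrow> real set" assume E: "\<And>i. i \<in> A \<times> A \<Longrightarrow> E i \<in> sets lborel"
  let ?M = "PiM (A \<times> A) (\<lambda>_. lborel :: real measure)" and ?T = "\<lambda>x. \<lambda>p\<in>A \<times> A. x (snd p, fst p)"
  have [measurable]: "?T \<in> measurable ?M ?M"
    by (rule measurable_restrict) (auto intro!: measurable_component_singleton)
  have "emeasure (distr ?M ?M ?T) (Pi\<^sub>E (A \<times> A) E) = emeasure ?M (Pi\<^sub>E (A \<times> A) (\<lambda>p. E (snd p, fst p)))"
    using E A by (subst emeasure_distr)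
      (auto intro!: arg_cong[where f = "emeasure _"] sets_PiM_I_finite simp: space_PiM PiE_iff Pi_iff)
  also have "\<dots> = (\<Prod>p\<in>A \<times> A. emeasure lborel (E (snd p, fst p)))"
    using A E by (intro lborel_PiM.emeasure_PiM) auto
  also have "\<dots> = (\<Prod>p\<in>A \<times> A. emeasure lborel (E p))"
    by (rule prod.reindex_bij_witness[where i = prod.swap and j = prod.swap]) auto
  finally show "emeasure (distr ?M ?M ?T) (Pi\<^sub>E (A \<times> A) E) = (\<Prod>p\<in>A \<times> A. emeasure lborel (E p))" .
qed (use A in auto)

section \<open>The Birkhoff polytope in corner coordinates\<close>

lemma corner_index_Suc: "corner_index (Suc N) = {..<N} \<times> {..<N}"
  by (simp add: corner_index_def)

text \<open>Here \<open>N = n - 1\<close>, and the last row and column are recovered from the unit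
  sums. The value \<open>0\<close> beyond \<open>N\<close> makes equal matrices equal as functions,
  so that symmetries can be stated as identities of functions.\<close>

definition fill :: "nat \<Rightarrow> (nat \<times> nat \<Rightarrow> real) \<Rightarrow> nat \<Rightarrow> nat \<Rightarrow> real" where
  "fill N c i j =
    (if N < i \<or> N < j then 0
     else if i < N \<and> j < N then c (i, j)
     else if i < N then 1 - (\<Sum>j<N. c (i, j))
     else if j < N then 1 - (\<Sum>i<N. c (i, j))
     else 1 - (\<Sum>i<N. 1 - (\<Sum>j<N. c (i, j))))"

text \<open>The device for computing \<open>fill\<close> of a transformed corner: it is enough to
  check sums and the corner of the candidate matrix.\<close>

lemma fill_unique:
  assumes row: "\<And>i. i < N \<Longrightarrow> (\<Sum>j\<le>N. X i j) = 1" and col: "\<And>j. j \<le> N \<Longrightarrow> (\<Sum>i\<le>N. X i j) = 1"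
    and c: "\<And>i j. i < N \<Longrightarrow> j < N \<Longrightarrow> c (i, j) = X i j"
    and out: "\<And>i j. N < i \<or> N < j \<Longrightarrow> X i j = 0"
  shows "fill N c = X"
proof (intro ext)
  fix i j
  have r: "1 - (\<Sum>j<N. c (i, j)) = X i N" if "i < N" for i
    using row[OF that] c[OF that] by (simp flip: lessThan_Suc_atMost)
  have l: "1 - (\<Sum>i<N. c (i, j)) = X N j" if "j < N" for j
    using col[of j] c that by (simp flip: lessThan_Suc_atMost)
  have "1 - (\<Sum>i<N. 1 - (\<Sum>j<N. c (i, j))) = 1 - (\<Sum>i<N. X i N)" using r by simp
  also have "\<dots> = X N N" using col[of N] by (simp flip: lessThan_Suc_atMost)
  finally show "fill N c i j = X i j"
    using r l c out by (auto simp: fill_def not_less le_less)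
qed

lemma fill_row_sum: "i \<le> N \<Longrightarrow> (\<Sum>j\<le>N. fill N c i j) = 1"
proof -
  assume i: "i \<le> N"
  have "(\<Sum>j\<le>N. fill N c i j) = (\<Sum>j<N. fill N c i j) + fill N c i N"
    by (simp flip: lessThan_Suc_atMost)
  also have "\<dots> = 1"
    using i by (cases "i = N")
      (simp_all add: fill_def sum_subtractf sum.swap[of "\<lambda>i j. c (i, j)" "{..<N}"])
  finally show ?thesis .
qed

lemma fill_col_sum: "j \<le> N \<Longrightarrow> (\<Sum>i\<le>N. fill N c i j) = 1"
proof -
  assume j: "j \<le> N"
  have "(\<Sum>i\<le>N. fill N c i j) = (\<Sum>i<N. fill N c i j) + fill N c N j"
    by (simp flip: lessThan_Suc_atMost)
  also have "\<dots> = 1"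
    using j by (cases "j = N") (simp_all add: fill_def)
  finally show ?thesis .
qed

abbreviation corner_lborel :: "nat \<Rightarrow> (nat \<times> nat \<Rightarrow> real) measure" where
  "corner_lborel N \<equiv> corner_measure (Suc N)"

lemma corner_lborel_def: "corner_lborel N = PiM ({..<N} \<times> {..<N}) (\<lambda>_. lborel)"
  by (simp add: corner_measure_def corner_index_Suc)

lemma measurable_fill [measurable]: "(\<lambda>c. fill N c i j) \<in> borel_measurable (corner_lborel N)"
proof -
  have "(\<lambda>c. c (i, j)) \<in> borel_measurable (PiM ({..<N} \<times> {..<N}) (\<lambda>_. lborel :: real measure))"
    if "i < N" "j < N" for i j
    using measurable_component_singleton[of "(i, j)" "{..<N} \<times> {..<N}" "\<lambda>_. lborel :: real measure"] that
    by simp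
  note comp = this
  show ?thesis
    unfolding corner_lborel_def
    by (cases "N < i \<or> N < j"; cases "i < N"; cases "j < N")
      (auto simp: fill_def intro!: borel_measurable_diff borel_measurable_sum comp)
qed

text \<open>Only signs are required: the unit sums hold identically by \<open>fill_row_sum\<close>
  and \<open>fill_col_sum\<close>.\<close>

definition birkhoff :: "nat \<Rightarrow> (nat \<times> nat \<Rightarrow> real) set" where
  "birkhoff N = {c \<in> space (corner_lborel N). \<forall>i\<le>N. \<forall>j\<le>N. 0 \<le> fill N c i j}"

lemma sets_birkhoff [measurable]: "birkhoff N \<in> sets (corner_lborel N)"
  unfolding birkhoff_def by measurable

lemma birkhoff_nonneg: "c \<in> birkhoff N \<Longrightarrow> 0 \<le> fill N c i j"
  by (cases "i \<le> N \<and> j \<le> N") (auto simp: birkhoff_def fill_def)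

lemma birkhoff_le_1: assumes "c \<in> birkhoff N" shows "fill N c i j \<le> 1"
proof (cases "i \<le> N \<and> j \<le> N")
  case True
  then have "fill N c i j \<le> (\<Sum>j\<le>N. fill N c i j)"
    using birkhoff_nonneg[OF assms] by (intro member_le_sum) auto
  then show ?thesis using fill_row_sum[of i N c] True by simp
qed (auto simp: fill_def)

section \<open>Measure-preserving symmetries of the polytope\<close>

text \<open>The operation acts on whole matrices, since moving the last row is not a coordinate
  permutation of the corner; \<open>T\<close> is its realization in corner coordinates.\<close>

definition birkhoff_symmetry :: "nat \<Rightarrow> ((nat \<Rightarrow> nat \<Rightarrow> real) \<Rightarrow> nat \<Rightarrow> nat \<Rightarrow> real) \<Rightarrow> bool" where
  "birkhoff_symmetry N \<pi> \<longleftrightarrow> (\<exists>T. T \<in> measurable (corner_lborel N) (corner_lborel N) \<and>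
     distr (corner_lborel N) (corner_lborel N) T = corner_lborel N \<and>
     (\<forall>c\<in>space (corner_lborel N). (T c \<in> birkhoff N \<longleftrightarrow> c \<in> birkhoff N) \<and> fill N (T c) = \<pi> (fill N c)))"

lemma birkhoff_symmetry_comp:
  assumes "birkhoff_symmetry N \<pi>" "birkhoff_symmetry N \<rho>"
  shows "birkhoff_symmetry N (\<pi> \<circ> \<rho>)"
proof -
  let ?M = "corner_lborel N"
  obtain S T where [measurable]: "S \<in> measurable ?M ?M" "T \<in> measurable ?M ?M"
    and d: "distr ?M ?M S = ?M" "distr ?M ?M T = ?M"
    and S: "\<forall>c\<in>space ?M. (S c \<in> birkhoff N \<longleftrightarrow> c \<in> birkhoff N) \<and> fill N (S c) = \<pi> (fill N c)"
    and T: "\<forall>c\<in>space ?M. (T c \<in> birkhoff N \<longleftrightarrow> c \<in> birkhoff N) \<and> fill N (T c) = \<rho> (fill N c)"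
    using assms unfolding birkhoff_symmetry_def by blast
  have "distr ?M ?M (S \<circ> T) = distr (distr ?M ?M T) ?M S" by (rule distr_distr[symmetric]) auto
  moreover have "T c \<in> space ?M" if "c \<in> space ?M" for c
    using that by (rule measurable_space[rotated]) simp
  ultimately show ?thesis
    unfolding birkhoff_symmetry_def using S T d by (intro exI[of _ "S \<circ> T"]) auto
qed

lemma birkhoff_symmetry_transpose: "birkhoff_symmetry N (\<lambda>X i j. X j i)"
proof -
  let ?M = "corner_lborel N"
  define T where "T = (\<lambda>c. \<lambda>p\<in>{..<N} \<times> {..<N}. c (snd p, fst p) :: real)"
  have T[measurable]: "T \<in> measurable ?M ?M"
    unfolding corner_lborel_def T_def
    by (rule measurable_restrict) (auto intro!: measurable_component_singleton)
  have fill: "fill N (T c) = (\<lambda>i j. fill N c j i)" for c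
    by (rule fill_unique) (auto simp: fill_row_sum fill_col_sum T_def, auto simp: fill_def)
  have "T c \<in> space ?M" if "c \<in> space ?M" for c
    using that by (rule measurable_space[rotated]) simp
  then have "T c \<in> birkhoff N \<longleftrightarrow> c \<in> birkhoff N" if "c \<in> space ?M" for c
    using that by (auto simp: birkhoff_def fill)
  moreover have "distr ?M ?M T = ?M"
    unfolding T_def corner_lborel_def by (rule distr_PiM_lborel_transpose) simp
  ultimately show ?thesis
    unfolding birkhoff_symmetry_def using T fill by blast
qed

text \<open>In corner coordinates row \<open>k\<close> is replaced by the column remainder: each
  \<open>c (k, j)\<close> is negated and shifted by an amount that depends on the other rows only.
  This is a shear with sign \<open>-1\<close>.\<close>

lemma birkhoff_symmetry_row_swap:
  assumes k: "k < N"
  shows "birkhoff_symmetry N (\<lambda>X i. X (Transposition.transpose k N i))"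
proof -
  let ?M = "corner_lborel N" and ?I = "{..<N} \<times> {..<N}" and ?t = "Transposition.transpose k N"
  define b :: "nat \<times> nat \<Rightarrow> (nat \<times> nat \<Rightarrow> real) \<Rightarrow> real" where "b = (\<lambda>p c. 1 - (\<Sum>i\<in>{..<N} - {k}. c (i, snd p)))"
  define T where "T = (\<lambda>c. \<lambda>p\<in>?I. if p \<in> {k} \<times> {..<N} then b p c + (- 1) * c p else c p)"
  have T_apply: "T c (i, j) = fill N c (?t i) j" if "i < N" "j < N" for c i j
    using that k by (auto simp: T_def b_def fill_def Transposition.transpose_def sum_diff1)
  have t: "?t i \<le> N \<longleftrightarrow> i \<le> N" for i
    using k by (auto simp: Transposition.transpose_def)
  have bij: "bij_betw ?t {..N} {..N}"
    by (rule bij_betw_byWitness[where f' = ?t]) (use t in auto)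
  have fill: "fill N (T c) = (\<lambda>i. fill N c (?t i))" for c
  proof (rule fill_unique)
    show "(\<Sum>i\<le>N. fill N c (?t i) j) = 1" if "j \<le> N" for j
      using sum.reindex_bij_betw[OF bij, of "\<lambda>i. fill N c i j"] fill_col_sum[OF that] by simp
    show "fill N c (?t i) j = 0" if "N < i \<or> N < j" for i j
      using that t[of i] by (auto simp: fill_def)
  qed (use t T_apply in \<open>auto simp: fill_row_sum\<close>)
  have b: "b p \<in> borel_measurable (PiM ?I (\<lambda>_. lborel))" if "p \<in> {k} \<times> {..<N}" for p
    unfolding b_def using that by (intro borel_measurable_diff borel_measurable_sum)
      (auto intro!: measurable_component_singleton[of _ ?I "\<lambda>_. lborel :: real measure", simplified])
  have T[measurable]: "T \<in> measurable ?M ?M"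
    unfolding corner_lborel_def T_def
  proof (rule measurable_restrict)
    fix p assume "p \<in> ?I"
    then show "(\<lambda>c. if p \<in> {k} \<times> {..<N} then b p c + (- 1) * c p else c p) \<in> measurable (PiM ?I (\<lambda>_. lborel)) lborel"
      using b[of p] by (cases "p \<in> {k} \<times> {..<N}") auto
  qed
  have sp: "T c \<in> space ?M" if "c \<in> space ?M" for c
    using that by (rule measurable_space[rotated]) simp
  have "T c \<in> birkhoff N \<longleftrightarrow> c \<in> birkhoff N" if "c \<in> space ?M" for c
  proof -
    have "(\<forall>i\<le>N. \<forall>j\<le>N. 0 \<le> fill N c (?t i) j) \<longleftrightarrow> (\<forall>i\<le>N. \<forall>j\<le>N. 0 \<le> fill N c i j)"
      using t by (metis transpose_involutory)
    then show ?thesis using that sp by (auto simp: birkhoff_def fill)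
  qed
  moreover have "distr ?M ?M T = ?M"
    unfolding T_def corner_lborel_def
  proof (rule distr_PiM_lborel_shear)
    show "b p x = b p y" if p: "p \<in> {k} \<times> {..<N}" and xy: "\<And>q. q \<in> ?I - {k} \<times> {..<N} \<Longrightarrow> x q = y q" for p x y
    proof -
      have "x (i, snd p) = y (i, snd p)" if "i \<in> {..<N} - {k}" for i
        using that p by (intro xy) auto
      then show ?thesis unfolding b_def by (intro arg_cong2[where f = "(-)"] refl sum.cong)
    qed
  qed (use b k in auto)
  ultimately show ?thesis
    unfolding birkhoff_symmetry_def using T fill by blast
qed

lemma birkhoff_symmetry_id: "birkhoff_symmetry N (\<lambda>X. X)"
  using birkhoff_symmetry_comp[OF birkhoff_symmetry_transpose birkhoff_symmetry_transpose, of N]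
  by (simp add: comp_def)

text \<open>Transpositions with the last row generate: \<open>(a b)\<close> is
  \<open>(a N) (b N) (a N)\<close> when \<open>b\<close> differs from \<open>N\<close>.\<close>

lemma birkhoff_symmetry_row_permute:
  assumes "\<sigma> permutes {..N}"
  shows "birkhoff_symmetry N (\<lambda>X i. X (\<sigma> i))"
proof -
  have top: "birkhoff_symmetry N (\<lambda>X i. X (Transposition.transpose a N i))" if "a \<le> N" for a
    using that birkhoff_symmetry_row_swap[of a N] by (cases "a = N") (auto simp: birkhoff_symmetry_id)
  have swap: "birkhoff_symmetry N (\<lambda>X i. X (Transposition.transpose a b i))" if "a \<le> N" "b \<le> N" "a \<noteq> b" for a b
  proof (cases "b = N")
    case False
    then have "Transposition.transpose a b i = Transposition.transpose a N (Transposition.transpose b N (Transposition.transpose a N i))" for i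
      using that by (auto simp: Transposition.transpose_def)
    then show ?thesis
      using birkhoff_symmetry_comp[OF top[OF that(1)] birkhoff_symmetry_comp[OF top[OF that(2)] top[OF that(1)]]]
      by (simp add: comp_def)
  qed (use top that in auto)
  show ?thesis
    using assms finite_atMost[of N]
  proof (induction rule: permutes_induct)
    case id
    show ?case by (simp add: birkhoff_symmetry_id)
  next
    case (swap a b p)
    show ?case
      using birkhoff_symmetry_comp[OF swap.IH \<open>\<And>a b. a \<le> N \<Longrightarrow> b \<le> N \<Longrightarrow> a \<noteq> b \<Longrightarrow> _\<close>[of a b]] swap.hyps
      by (simp add: comp_def)
  qed
qed

text \<open>Column permutations are row permutations conjugated by transposition.\<close>

lemma birkhoff_symmetry_permute:
  assumes "\<sigma> permutes {..N}" "\<tau> permutes {..N}"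
  shows "birkhoff_symmetry N (\<lambda>X i j. X (\<sigma> i) (\<tau> j))"
  using birkhoff_symmetry_comp[OF birkhoff_symmetry_row_permute[OF assms(1)]
    birkhoff_symmetry_comp[OF birkhoff_symmetry_transpose
    birkhoff_symmetry_comp[OF birkhoff_symmetry_row_permute[OF assms(2)] birkhoff_symmetry_transpose]]]
  by (simp add: comp_def)

section \<open>Volume of the polytope\<close>

lemma nat_floor_eq_imp_close:
  fixes x y :: real
  assumes "nat \<lfloor>x\<rfloor> = nat \<lfloor>y\<rfloor>" "0 \<le> x" "0 \<le> y"
  shows "\<bar>x - y\<bar> \<le> 1"
proof -
  have "\<lfloor>x\<rfloor> = \<lfloor>y\<rfloor>" using assms by (simp add: eq_nat_nat_iff)
  then show ?thesis by linarith
qed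

lemma emeasure_birkhoff_le_1: "emeasure (corner_lborel N) (birkhoff N) \<le> 1"
proof -
  let ?I = "{..<N} \<times> {..<N}"
  have "birkhoff N \<subseteq> Pi\<^sub>E ?I (\<lambda>_. {0..1})"
  proof
    fix c assume c: "c \<in> birkhoff N"
    then have "c (i, j) = fill N c i j" if "i < N" "j < N" for i j
      using that by (simp add: fill_def)
    then show "c \<in> Pi\<^sub>E ?I (\<lambda>_. {0..1})"
      using birkhoff_nonneg[OF c] birkhoff_le_1[OF c] c
      by (auto simp: PiE_iff birkhoff_def corner_lborel_def space_PiM)
  qed
  then have "emeasure (corner_lborel N) (birkhoff N) \<le> emeasure (corner_lborel N) (Pi\<^sub>E ?I (\<lambda>_. {0..1}))"
    by (rule emeasure_mono) (auto simp: corner_lborel_def intro!: sets_PiM_I_finite)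
  also have "\<dots> = 1"
    unfolding corner_lborel_def by (subst lborel_PiM.emeasure_PiM) auto
  finally show ?thesis .
qed

text \<open>Pigeonhole: sort the points of the cube with side \<open>1 / (N + 1)\<close> by their row and column
  sums, rounded to multiples of \<open>1 / (N + 1)\<^sup>2\<close>. The difference of two points in the same cell
  has so small row and column sums that adding it to the constant matrix stays in the polytope.\<close>

lemma emeasure_birkhoff_ge:
  "ennreal ((1 / Suc N) ^ (N * N)) \<le> ennreal (Suc N ^ (4 * N)) * emeasure (corner_lborel N) (birkhoff N)"
proof -
  let ?M = "corner_lborel N" and ?I = "{..<N} \<times> {..<N}"
  define n where "n = real (Suc N)"
  have n: "n \<ge> 1" and N: "real N / n = 1 - 1 / n" by (auto simp: n_def field_simps)
  define R where "R c i = (\<Sum>j<N. c (i, j) :: real)" for c :: "nat \<times> nat \<Rightarrow> real" and i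
  define C where "C c j = (\<Sum>i<N. c (i, j) :: real)" for c :: "nat \<times> nat \<Rightarrow> real" and j
  define Q where "Q = Pi\<^sub>E ?I (\<lambda>_. {0..<1/n})"
  define cell where "cell z = {c \<in> Q. (\<forall>i<N. nat \<lfloor>n\<^sup>2 * R c i\<rfloor> = fst z i) \<and> (\<forall>j<N. nat \<lfloor>n\<^sup>2 * C c j\<rfloor> = snd z j)}"
    for z :: "(nat \<Rightarrow> nat) \<times> (nat \<Rightarrow> nat)"
  \<comment> \<open>There are \<open>2 * N\<close> rounded sums with at most
    \<open>(N + 1)^2\<close> values each, since the sums of points of \<open>Q\<close> are below
    \<open>1\<close>. This count is the factor \<open>Suc N ^ (4 * N)\<close>.\<close>
  define K where "K = ({..<N} \<rightarrow>\<^sub>E {..<(Suc N)\<^sup>2}) \<times> ({..<N} \<rightarrow>\<^sub>E {..<(Suc N)\<^sup>2})"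
  have Qs[measurable]: "Q \<in> sets ?M"
    unfolding Q_def corner_lborel_def by (intro sets_PiM_I_finite) auto
  have sp: "Q \<subseteq> space ?M" by (rule sets.sets_into_space[OF Qs])
  have comp: "(\<lambda>c. c (i, j)) \<in> borel_measurable ?M" if "i < N" "j < N" for i j
    unfolding corner_lborel_def
    using measurable_component_singleton[of "(i, j)" "{..<N} \<times> {..<N}" "\<lambda>_. lborel :: real measure"] that
    by simp
  have R[measurable]: "(\<lambda>c. R c i) \<in> borel_measurable ?M" if "i < N" for i
    unfolding R_def using that by (auto intro!: borel_measurable_sum comp)
  have C[measurable]: "(\<lambda>c. C c i) \<in> borel_measurable ?M" if "i < N" for i
    unfolding C_def using that by (auto intro!: borel_measurable_sum comp)
  have cell_sets: "cell z \<in> sets ?M" for z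
  proof -
    have "{c \<in> space ?M. \<forall>i<N. nat \<lfloor>n\<^sup>2 * R c i\<rfloor> = fst z i} \<in> sets ?M"
      "{c \<in> space ?M. \<forall>i<N. nat \<lfloor>n\<^sup>2 * C c i\<rfloor> = snd z i} \<in> sets ?M"
      by (auto intro!: sets.sets_Collect_countable_All' sets.sets_Collect_finite_All'
        simp: Ball_def[symmetric] lessThan_iff[symmetric] simp del: lessThan_iff) 
    then have "Q \<inter> {c \<in> space ?M. \<forall>i<N. nat \<lfloor>n\<^sup>2 * R c i\<rfloor> = fst z i}
      \<inter> {c \<in> space ?M. \<forall>i<N. nat \<lfloor>n\<^sup>2 * C c i\<rfloor> = snd z i} \<in> sets ?M" by auto
    also have "Q \<inter> {c \<in> space ?M. \<forall>i<N. nat \<lfloor>n\<^sup>2 * R c i\<rfloor> = fst z i}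
      \<inter> {c \<in> space ?M. \<forall>i<N. nat \<lfloor>n\<^sup>2 * C c i\<rfloor> = snd z i} = cell z"
      using sp by (auto simp: cell_def)
    finally show ?thesis .
  qed
  have Qb: "0 \<le> c (i, j)" "c (i, j) < 1 / n" if "c \<in> Q" "i < N" "j < N" for c i j
    using that by (auto simp: Q_def PiE_iff)
  have RC0: "0 \<le> R c i" "0 \<le> C c i" if "c \<in> Q" "i < N" for c i
    using that Qb by (auto simp: R_def C_def intro!: sum_nonneg)
  have RC1: "R c i < 1" "C c i < 1" if c: "c \<in> Q" and i: "i < N" for c i
  proof -
    have "R c i \<le> (\<Sum>j<N. 1 / n)" "C c i \<le> (\<Sum>j<N. 1 / n)"
      unfolding R_def C_def using Qb[OF c] i by (intro sum_mono; force intro: less_imp_le)+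
    moreover have "(\<Sum>j<N. 1 / n) < 1" using n by (simp add: N)
    ultimately show "R c i < 1" "C c i < 1" by auto
  qed
  have "Q \<subseteq> (\<Union>z\<in>K. cell z)"
  proof
    fix c assume c: "c \<in> Q"
    define z where "z = (\<lambda>i\<in>{..<N}. nat \<lfloor>n\<^sup>2 * R c i\<rfloor>, \<lambda>i\<in>{..<N}. nat \<lfloor>n\<^sup>2 * C c i\<rfloor>)"
    have "nat \<lfloor>n\<^sup>2 * x\<rfloor> < (Suc N)\<^sup>2" if "0 \<le> x" "x < 1" for x
    proof -
      have "n\<^sup>2 * x < n\<^sup>2" using that n by simp
      also have "n\<^sup>2 = real ((Suc N)\<^sup>2)" by (simp add: n_def)
      finally have "\<lfloor>n\<^sup>2 * x\<rfloor> < int ((Suc N)\<^sup>2)" by (simp add: floor_less_iff del: of_nat_power)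
      then show ?thesis by (simp add: nat_less_iff that del: of_nat_power)
    qed
    then have "z \<in> K" using RC0[OF c] RC1[OF c] by (auto simp: z_def K_def)
    moreover have "c \<in> cell z" using c by (auto simp: cell_def z_def)
    ultimately show "c \<in> (\<Union>z\<in>K. cell z)" by blast
  qed
  have finK: "finite K" by (auto simp: K_def intro!: finite_PiE)
  have cell_le: "emeasure ?M (cell z) \<le> emeasure ?M (birkhoff N)" for z
  proof (cases "cell z = {}")
    case False
    then obtain d where d: "d \<in> cell z" by auto
    define T where "T = (\<lambda>c. \<lambda>p\<in>?I. (1 / n - d p) + c p)"
    have T[measurable]: "T \<in> measurable ?M ?M"
      unfolding corner_lborel_def T_def by (rule measurable_restrict) auto
    have dist: "distr ?M ?M T = ?M"
      unfolding T_def corner_lborel_def by (rule distr_PiM_lborel_translate) simp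
    have Tb: "T c \<in> birkhoff N" if c: "c \<in> cell z" for c
    proof -
      have cd: "c \<in> Q" "d \<in> Q" using c d by (auto simp: cell_def)
      have scale: "\<bar>a - b\<bar> * n\<^sup>2 = \<bar>n\<^sup>2 * a - n\<^sup>2 * b\<bar>" for a b
        by (simp add: abs_mult mult.commute[of _ "n\<^sup>2"] flip: right_diff_distrib)
      have close: "\<bar>R c i - R d i\<bar> \<le> 1 / n\<^sup>2" "\<bar>C c i - C d i\<bar> \<le> 1 / n\<^sup>2" if i: "i < N" for i
      proof -
        have "\<bar>n\<^sup>2 * R c i - n\<^sup>2 * R d i\<bar> \<le> 1" "\<bar>n\<^sup>2 * C c i - n\<^sup>2 * C d i\<bar> \<le> 1"
          using c d i RC0[OF cd(1) i] RC0[OF cd(2) i]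
          by (auto simp: cell_def intro!: nat_floor_eq_imp_close)
        then show "\<bar>R c i - R d i\<bar> \<le> 1 / n\<^sup>2" "\<bar>C c i - C d i\<bar> \<le> 1 / n\<^sup>2"
          using n by (auto simp: pos_le_divide_eq scale)
      qed
      have sq: "1 / n\<^sup>2 \<le> 1 / n" using n by (intro divide_left_mono) (auto intro: self_le_power)
      have Tc: "T c (i, j) = 1 / n - d (i, j) + c (i, j)" if "i < N" "j < N" for i j
        using that by (simp add: T_def)
      have r: "1 - (\<Sum>j<N. T c (i, j)) = 1 / n - (R c i - R d i)" if "i < N" for i
        using that by (simp add: Tc sum.distrib sum_subtractf R_def N)
      have s: "1 - (\<Sum>i<N. T c (i, j)) = 1 / n - (C c j - C d j)" if "j < N" for j
        using that by (simp add: Tc sum.distrib sum_subtractf C_def N)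
      \<comment> \<open>The entry \<open>(N, N)\<close> collects all \<open>N\<close> row deviations
        and its change must stay within \<open>1 / n\<close>; this is why the mesh is
        \<open>1 / n^2\<close> and not \<open>1 / n\<close>.\<close>
      have "\<bar>\<Sum>i<N. R c i - R d i\<bar> \<le> (\<Sum>i<N. 1 / n\<^sup>2)"
        using close by (intro order_trans[OF sum_abs] sum_mono) auto
      also have "\<dots> = (1 - 1 / n) * (1 / n)" by (simp add: power2_eq_square N[symmetric])
      also have "\<dots> \<le> 1 / n" using n by (intro mult_left_le_one_le) auto
      finally have RR: "\<bar>\<Sum>i<N. R c i - R d i\<bar> \<le> 1 / n" .
      have "1 - (\<Sum>i<N. 1 - (\<Sum>j<N. T c (i, j))) = 1 - (\<Sum>i<N. 1 / n - (R c i - R d i))"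
        using r by simp
      also have "\<dots> = 1 / n + (\<Sum>i<N. R c i - R d i)"
        by (simp add: sum_subtractf N)
      finally have "1 - (\<Sum>i<N. 1 - (\<Sum>j<N. T c (i, j))) \<ge> 0" using RR by linarith
      moreover have "0 \<le> T c (i, j)" if "i < N" "j < N" for i j
        using that Qb[OF cd(1), of i j] Qb[OF cd(2), of i j] by (simp add: Tc)
      moreover have "0 \<le> 1 - (\<Sum>j<N. T c (i, j))" "0 \<le> 1 - (\<Sum>j<N. T c (j, i))" if "i < N" for i
        using close[OF that] sq unfolding r[OF that] s[OF that] by linarith+
      moreover have "T c \<in> space ?M" using cd sp by (intro measurable_space[OF T]) auto
      ultimately show ?thesis by (simp add: birkhoff_def fill_def)
    qed
    have "emeasure ?M (cell z) \<le> emeasure ?M (T -` birkhoff N \<inter> space ?M)"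
      using Tb sp by (intro emeasure_mono) (auto simp: cell_def)
    also have "\<dots> = emeasure (distr ?M ?M T) (birkhoff N)" by (subst emeasure_distr) auto
    finally show ?thesis by (simp add: dist)
  qed simp
  have "ennreal ((1 / n) ^ (N * N)) = emeasure ?M Q"
    unfolding Q_def corner_lborel_def using n
    by (subst lborel_PiM.emeasure_PiM) (auto simp: ennreal_power card_cartesian_product)
  also have "emeasure ?M Q \<le> emeasure ?M (\<Union>z\<in>K. cell z)"
    using \<open>Q \<subseteq> (\<Union>z\<in>K. cell z)\<close> cell_sets finK by (intro emeasure_mono) auto
  also have "\<dots> \<le> (\<Sum>z\<in>K. emeasure ?M (cell z))"
    using finK cell_sets by (intro emeasure_subadditive_finite) auto
  also have "\<dots> \<le> (\<Sum>z\<in>K. emeasure ?M (birkhoff N))" by (intro sum_mono cell_le)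
  also have "\<dots> = of_nat (card K) * emeasure ?M (birkhoff N)" by simp
  also have "card K = Suc N ^ (4 * N)"
    by (simp add: K_def card_cartesian_product card_PiE power_mult[symmetric] power_add[symmetric] del: power_Suc)
  finally show ?thesis unfolding n_def ennreal_of_nat_eq_real_of_nat .
qed

lemma emeasure_birkhoff_nonzero: "emeasure (corner_lborel N) (birkhoff N) \<noteq> 0"
proof
  assume "emeasure (corner_lborel N) (birkhoff N) = 0"
  then have "ennreal ((1 / Suc N) ^ (N * N)) \<le> 0" using emeasure_birkhoff_ge[of N] by simp
  moreover have "0 < (1 / real (Suc N)) ^ (N * N)" by (intro zero_less_power) simp
  ultimately show False by (simp add: ennreal_le_iff2 del: of_nat_Suc)
qed

section \<open>The uniform distribution\<close>

definition uniform_birkhoff :: "nat \<Rightarrow> (nat \<times> nat \<Rightarrow> real) measure" where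
  "uniform_birkhoff N = uniform_measure (corner_lborel N) (birkhoff N)"

lemma sets_uniform_birkhoff [measurable_cong, simp]: "sets (uniform_birkhoff N) = sets (corner_lborel N)"
  by (simp add: uniform_birkhoff_def)

lemma space_uniform_birkhoff [simp]: "space (uniform_birkhoff N) = space (corner_lborel N)"
  by (simp add: uniform_birkhoff_def)

lemma emeasure_birkhoff_finite: "emeasure (corner_lborel N) (birkhoff N) \<noteq> \<infinity>"
  using emeasure_birkhoff_le_1[of N] by (auto simp: top_unique)

lemma prob_space_uniform_birkhoff: "prob_space (uniform_birkhoff N)"
  unfolding uniform_birkhoff_def
  by (rule prob_space_uniform_measure[OF emeasure_birkhoff_nonzero emeasure_birkhoff_finite])

interpretation uniform_birkhoff: prob_space "uniform_birkhoff N" for N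
  by (rule prob_space_uniform_birkhoff)

lemma AE_uniform_birkhoffI: "(\<And>c. c \<in> birkhoff N \<Longrightarrow> P c) \<Longrightarrow> AE c in uniform_birkhoff N. P c"
  unfolding uniform_birkhoff_def by (rule AE_uniform_measureI) auto

lemma nn_integral_uniform_birkhoff:
  assumes "f \<in> borel_measurable (corner_lborel N)"
  shows "(\<integral>\<^sup>+c. f c \<partial>uniform_birkhoff N) =
    (\<integral>\<^sup>+c. f c * indicator (birkhoff N) c \<partial>corner_lborel N) / emeasure (corner_lborel N) (birkhoff N)"
  unfolding uniform_birkhoff_def by (rule nn_integral_uniform_measure[OF assms sets_birkhoff])

section \<open>Expectations of bounded functions of the full matrix\<close>

text \<open>Boundedness is asked on the polytope only, because the entries of \<open>fill\<close>
  are unbounded over all corners.\<close>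

definition bounded_observable :: "nat \<Rightarrow> ((nat \<Rightarrow> nat \<Rightarrow> real) \<Rightarrow> real) \<Rightarrow> bool" where
  "bounded_observable N f \<longleftrightarrow> (\<lambda>c. f (fill N c)) \<in> borel_measurable (corner_lborel N) \<and>
     (\<exists>C. \<forall>c\<in>birkhoff N. \<bar>f (fill N c)\<bar> \<le> C)"

definition birkhoff_expectation :: "nat \<Rightarrow> ((nat \<Rightarrow> nat \<Rightarrow> real) \<Rightarrow> real) \<Rightarrow> real" where
  "birkhoff_expectation N f = (\<integral>c. f (fill N c) \<partial>uniform_birkhoff N)"

named_theorems observable

lemma bounded_observable_entry [observable]: "bounded_observable N (\<lambda>X. X i j)"
  unfolding bounded_observable_def
  by (auto intro!: exI[of _ 1] simp: birkhoff_nonneg birkhoff_le_1)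

lemma bounded_observable_const [observable]: "bounded_observable N (\<lambda>X. a)"
  unfolding bounded_observable_def by auto

lemma bounded_observable_add [observable]:
  assumes "bounded_observable N f" "bounded_observable N g"
  shows "bounded_observable N (\<lambda>X. f X + g X)"
proof -
  obtain C D where "\<forall>c\<in>birkhoff N. \<bar>f (fill N c)\<bar> \<le> C" "\<forall>c\<in>birkhoff N. \<bar>g (fill N c)\<bar> \<le> D"
    using assms by (auto simp: bounded_observable_def)
  then have "\<forall>c\<in>birkhoff N. \<bar>f (fill N c) + g (fill N c)\<bar> \<le> C + D"
    by (smt (verit))
  then show ?thesis using assms by (auto simp: bounded_observable_def)
qed

lemma bounded_observable_mult [observable]:
  assumes "bounded_observable N f" "bounded_observable N g"
  shows "bounded_observable N (\<lambda>X. f X * g X)"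
proof -
  obtain C D where C: "\<forall>c\<in>birkhoff N. \<bar>f (fill N c)\<bar> \<le> C" and D: "\<forall>c\<in>birkhoff N. \<bar>g (fill N c)\<bar> \<le> D"
    using assms by (auto simp: bounded_observable_def)
  have "\<bar>f (fill N c) * g (fill N c)\<bar> \<le> C * D" if "c \<in> birkhoff N" for c
    unfolding abs_mult using C D that by (intro mult_mono) (auto intro: order_trans[OF abs_ge_zero])
  then show ?thesis using assms by (auto simp: bounded_observable_def)
qed

lemma bounded_observable_power [observable]:
  "bounded_observable N f \<Longrightarrow> bounded_observable N (\<lambda>X. f X ^ p)"
  by (induction p) (auto intro: observable)

lemma bounded_observable_diff [observable]:
  "bounded_observable N f \<Longrightarrow> bounded_observable N g \<Longrightarrow> bounded_observable N (\<lambda>X. f X - g X)"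
  using bounded_observable_add[of N f "\<lambda>X. (- 1) * g X"]
    bounded_observable_mult[OF bounded_observable_const, of N g "- 1"] by simp

lemma bounded_observable_sum [observable]:
  "(\<And>i. i \<in> A \<Longrightarrow> bounded_observable N (f i)) \<Longrightarrow> bounded_observable N (\<lambda>X. \<Sum>i\<in>A. f i X)"
  by (induction A rule: infinite_finite_induct) (auto intro: observable)

lemma bounded_observable_measurable:
  "bounded_observable N f \<Longrightarrow> (\<lambda>c. f (fill N c)) \<in> borel_measurable (corner_lborel N)"
  by (simp add: bounded_observable_def)

lemma bounded_observable_integrable:
  assumes "bounded_observable N f"
  shows "integrable (uniform_birkhoff N) (\<lambda>c. f (fill N c))"
proof -
  obtain C where "\<forall>c\<in>birkhoff N. \<bar>f (fill N c)\<bar> \<le> C"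
    using assms by (auto simp: bounded_observable_def)
  then have "AE c in uniform_birkhoff N. norm (f (fill N c)) \<le> C"
    by (intro AE_uniform_birkhoffI) auto
  then show ?thesis
    using bounded_observable_measurable[OF assms]
    by (intro uniform_birkhoff.integrable_const_bound) auto
qed

lemma birkhoff_expectation_const [simp]: "birkhoff_expectation N (\<lambda>X. a) = a"
  using uniform_birkhoff.prob_space[of N] by (simp add: birkhoff_expectation_def)

lemma birkhoff_expectation_add:
  "bounded_observable N f \<Longrightarrow> bounded_observable N g \<Longrightarrow>
    birkhoff_expectation N (\<lambda>X. f X + g X) = birkhoff_expectation N f + birkhoff_expectation N g"
  by (simp add: birkhoff_expectation_def bounded_observable_integrable)

lemma birkhoff_expectation_diff:
  "bounded_observable N f \<Longrightarrow> bounded_observable N g \<Longrightarrow>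
    birkhoff_expectation N (\<lambda>X. f X - g X) = birkhoff_expectation N f - birkhoff_expectation N g"
  by (simp add: birkhoff_expectation_def bounded_observable_integrable)

lemma birkhoff_expectation_cmult:
  "birkhoff_expectation N (\<lambda>X. a * f X) = a * birkhoff_expectation N f"
  by (simp add: birkhoff_expectation_def)

lemma birkhoff_expectation_sum:
  "(\<And>i. i \<in> A \<Longrightarrow> bounded_observable N (f i)) \<Longrightarrow>
    birkhoff_expectation N (\<lambda>X. \<Sum>i\<in>A. f i X) = (\<Sum>i\<in>A. birkhoff_expectation N (f i))"
  by (simp add: birkhoff_expectation_def bounded_observable_integrable)

lemma birkhoff_expectation_mono:
  assumes "bounded_observable N f" "bounded_observable N g"
    and "\<And>c. c \<in> birkhoff N \<Longrightarrow> f (fill N c) \<le> g (fill N c)"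
  shows "birkhoff_expectation N f \<le> birkhoff_expectation N g"
  unfolding birkhoff_expectation_def
  by (intro integral_mono_AE bounded_observable_integrable AE_uniform_birkhoffI assms)

lemma birkhoff_expectation_nonneg:
  assumes "\<And>c. c \<in> birkhoff N \<Longrightarrow> 0 \<le> f (fill N c)"
  shows "0 \<le> birkhoff_expectation N f"
  unfolding birkhoff_expectation_def
  by (intro integral_nonneg_AE AE_uniform_birkhoffI assms)

lemma birkhoff_expectation_symmetry:
  assumes "birkhoff_symmetry N \<pi>" and f: "bounded_observable N f"
  shows "birkhoff_expectation N (\<lambda>X. f (\<pi> X)) = birkhoff_expectation N f"
proof -
  let ?M = "corner_lborel N" and ?U = "uniform_birkhoff N"
  obtain T where T[measurable]: "T \<in> measurable ?M ?M" and d: "distr ?M ?M T = ?M"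
    and T': "\<forall>c\<in>space ?M. (T c \<in> birkhoff N \<longleftrightarrow> c \<in> birkhoff N) \<and> fill N (T c) = \<pi> (fill N c)"
    using assms unfolding birkhoff_symmetry_def by blast
  have "distr ?U ?U T = ?U"
  proof (rule measure_eqI)
    fix A assume "A \<in> sets (distr ?U ?U T)"
    then have A[measurable]: "A \<in> sets ?M" by simp
    have "emeasure (distr ?U ?U T) A = emeasure ?M (birkhoff N \<inter> (T -` A \<inter> space ?M)) / emeasure ?M (birkhoff N)"
      by (subst emeasure_distr) (auto simp: uniform_birkhoff_def)
    also have "birkhoff N \<inter> (T -` A \<inter> space ?M) = T -` (birkhoff N \<inter> A) \<inter> space ?M"
      using T' by (auto simp: birkhoff_def)
    also have "emeasure ?M \<dots> = emeasure (distr ?M ?M T) (birkhoff N \<inter> A)"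
      by (subst emeasure_distr) auto
    also have "\<dots> / emeasure ?M (birkhoff N) = emeasure ?U A"
      by (simp add: d) (simp add: uniform_birkhoff_def)
    finally show "emeasure (distr ?U ?U T) A = emeasure ?U A" .
  qed simp
  then have "birkhoff_expectation N f = (\<integral>c. f (fill N c) \<partial>distr ?U ?U T)"
    by (simp add: birkhoff_expectation_def)
  also have "\<dots> = (\<integral>c. f (fill N (T c)) \<partial>?U)"
    using bounded_observable_measurable[OF f] by (intro integral_distr) auto
  also have "\<dots> = birkhoff_expectation N (\<lambda>X. f (\<pi> X))"
    unfolding birkhoff_expectation_def by (intro Bochner_Integration.integral_cong) (use T' in auto)
  finally show ?thesis by simp
qed

text \<open>The volume of the polytope cancels, so moment inequalities reduce to unnormalized
  integrals, the form that Fubini over two rows produces.\<close>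

lemma birkhoff_expectation_leI:
  assumes f: "bounded_observable N f" "\<And>c. c \<in> birkhoff N \<Longrightarrow> 0 \<le> f (fill N c)"
    and g: "bounded_observable N g" "\<And>c. c \<in> birkhoff N \<Longrightarrow> 0 \<le> g (fill N c)" and C: "0 \<le> C"
    and le: "(\<integral>\<^sup>+c. ennreal (f (fill N c)) * indicator (birkhoff N) c \<partial>corner_lborel N)
      \<le> ennreal C * (\<integral>\<^sup>+c. ennreal (g (fill N c)) * indicator (birkhoff N) c \<partial>corner_lborel N)"
  shows "birkhoff_expectation N f \<le> C * birkhoff_expectation N g"
proof -
  have eq: "ennreal (birkhoff_expectation N h) = (\<integral>\<^sup>+c. ennreal (h (fill N c)) * indicator (birkhoff N) c \<partial>corner_lborel N)
      / emeasure (corner_lborel N) (birkhoff N)"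
    if "bounded_observable N h" "\<And>c. c \<in> birkhoff N \<Longrightarrow> 0 \<le> h (fill N c)" for h
  proof -
    have "ennreal (birkhoff_expectation N h) = (\<integral>\<^sup>+c. ennreal (h (fill N c)) \<partial>uniform_birkhoff N)"
      unfolding birkhoff_expectation_def using that
      by (intro nn_integral_eq_integral[symmetric] bounded_observable_integrable AE_uniform_birkhoffI)
    then show ?thesis
      using bounded_observable_measurable[OF that(1)] by (simp add: nn_integral_uniform_birkhoff)
  qed
  have "ennreal (birkhoff_expectation N f) \<le> ennreal C * ennreal (birkhoff_expectation N g)"
    using divide_right_mono_ennreal[OF le] by (simp add: eq f g ennreal_times_divide)
  moreover have "0 \<le> birkhoff_expectation N g" by (rule birkhoff_expectation_nonneg) (rule g)
  ultimately show ?thesis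
    using C by (simp add: ennreal_mult[symmetric] ennreal_le_iff)
qed

section \<open>Resampling two rows\<close>

lemma merge_row:
  assumes k: "k < N" and c: "c = merge ({..<N} \<times> {..<N} - {k} \<times> {..<N}) ({k} \<times> {..<N}) (r, y)"
  defines "s \<equiv> \<lambda>j. 1 - (\<Sum>i\<in>{..<N} - {k}. r (i, j))"
  shows "i < N \<Longrightarrow> j < N \<Longrightarrow> i \<noteq> k \<Longrightarrow> fill N c i j = r (i, j)"
    and "i < N \<Longrightarrow> i \<noteq> k \<Longrightarrow> fill N c i N = 1 - (\<Sum>j<N. r (i, j))"
    and "j < N \<Longrightarrow> fill N c k j = y (k, j)"
    and "j < N \<Longrightarrow> fill N c N j = s j - y (k, j)"
    and "fill N c k N = 1 - (\<Sum>j<N. y (k, j))"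
    and "fill N c N N = 1 - (\<Sum>j<N. s j - y (k, j))"
proof -
  have ck: "j < N \<Longrightarrow> c (k, j) = y (k, j)" and cr: "i < N \<Longrightarrow> j < N \<Longrightarrow> i \<noteq> k \<Longrightarrow> c (i, j) = r (i, j)" for i j
    using k by (auto simp: c)
  show a: "j < N \<Longrightarrow> fill N c N j = s j - y (k, j)" for j
  proof -
    assume j: "j < N"
    have "(\<Sum>i<N. c (i, j)) = c (k, j) + (\<Sum>i\<in>{..<N} - {k}. c (i, j))"
      using k by (subst sum.remove[of _ k]) auto
    also have "(\<Sum>i\<in>{..<N} - {k}. c (i, j)) = (\<Sum>i\<in>{..<N} - {k}. r (i, j))"
      using cr j by (intro sum.cong) auto
    finally show ?thesis using j by (simp add: fill_def s_def ck)
  qed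
  show "fill N c N N = 1 - (\<Sum>j<N. s j - y (k, j))"
    using fill_row_sum[of N N c] a by (simp flip: lessThan_Suc_atMost)
qed (use k in \<open>auto simp: fill_def c\<close>)

text \<open>With the other rows fixed, the columns \<open>j < N\<close> confine row \<open>k\<close>
  to the box \<open>0 <= y (k, j) <= s j\<close>. The entries \<open>(k, N)\<close> and
  \<open>(N, N)\<close> are nonnegative exactly when the sum of row \<open>k\<close> lies between
  \<open>(SUM s) - 1\<close> and \<open>1\<close>, an interval centred at half of
  \<open>SUM s\<close>. Its half-width is half of \<open>2 - SUM s\<close>, the mass that the other
  rows leave in column \<open>N\<close>.\<close>

lemma merge_row_mem_birkhoff:
  assumes k: "k < N" and c: "c = merge ({..<N} \<times> {..<N} - {k} \<times> {..<N}) ({k} \<times> {..<N}) (r, y)"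
  defines "s \<equiv> \<lambda>j. 1 - (\<Sum>i\<in>{..<N} - {k}. r (i, j))"
  shows "c \<in> birkhoff N \<longleftrightarrow>
    (\<forall>i<N. i \<noteq> k \<longrightarrow> (\<forall>j<N. 0 \<le> r (i, j)) \<and> 0 \<le> 1 - (\<Sum>j<N. r (i, j))) \<and>
    y \<in> slab ({k} \<times> {..<N}) (\<lambda>p. s (snd p)) (1 - (\<Sum>j<N. s j) / 2)"
proof -
  note m = merge_row[OF k c, folded s_def]
  have space: "c \<in> space (corner_lborel N)"
  proof -
    have "{..<N} \<times> {..<N} - {k} \<times> {..<N} \<union> {k} \<times> {..<N} = {..<N} \<times> {..<N}" using k by auto
    then show ?thesis
      using extensional_merge[of "{..<N} \<times> {..<N} - {k} \<times> {..<N}" "{k} \<times> {..<N}" r y]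
      unfolding c corner_lborel_def by (simp add: space_PiM PiE_def)
  qed
  have all_le: "(\<forall>i\<le>N. P i) \<longleftrightarrow> (\<forall>i<N. P i) \<and> P N" for P
    by (auto simp: le_less)
  have mem: "c \<in> birkhoff N \<longleftrightarrow> (\<forall>i<N. i \<noteq> k \<longrightarrow> (\<forall>j<N. 0 \<le> fill N c i j) \<and> 0 \<le> fill N c i N) \<and>
      ((\<forall>j<N. 0 \<le> fill N c k j) \<and> 0 \<le> fill N c k N) \<and> (\<forall>j<N. 0 \<le> fill N c N j) \<and> 0 \<le> fill N c N N"
    unfolding birkhoff_def mem_Collect_eq all_le using space k by blast
  have "(\<Sum>p\<in>{k} \<times> {..<N}. y p - s (snd p) / 2) = (\<Sum>j<N. y (k, j) - s j / 2)"
    by (simp add: sum.cartesian_product')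
  also have "\<dots> = (\<Sum>j<N. y (k, j)) - (\<Sum>j<N. s j) / 2"
    by (simp add: sum_subtractf sum_divide_distrib)
  finally have slab: "y \<in> slab ({k} \<times> {..<N}) (\<lambda>p. s (snd p)) (1 - (\<Sum>j<N. s j) / 2) \<longleftrightarrow>
      (\<forall>j<N. 0 \<le> y (k, j) \<and> y (k, j) \<le> s j) \<and> 0 \<le> 1 - (\<Sum>j<N. y (k, j)) \<and> 0 \<le> 1 - (\<Sum>j<N. s j - y (k, j))"
    by (auto simp: slab_def abs_le_iff sum_subtractf)
  show ?thesis
    unfolding slab mem using m by (auto simp: s_def)
qed

text \<open>Fubini over the kept rows reduces the polytope to its slab fibres. As the constant
  \<open>C\<close> is the same on all of them, the volumes of the fibres never have to be
  compared.\<close>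

lemma birkhoff_resample_row:
  fixes G H :: "(nat \<times> nat \<Rightarrow> real) \<Rightarrow> ennreal"
  assumes k: "k < N" and [measurable]: "G \<in> borel_measurable (corner_lborel N)" "H \<in> borel_measurable (corner_lborel N)"
  defines "R \<equiv> {..<N} \<times> {..<N} - {k} \<times> {..<N}" and "S \<equiv> {k} \<times> {..<N}"
    and "s \<equiv> \<lambda>r p. 1 - (\<Sum>i\<in>{..<N} - {k}. r (i, snd p :: nat))"
  assumes le: "\<And>r w. (\<And>i j. i < N \<Longrightarrow> i \<noteq> k \<Longrightarrow> j < N \<Longrightarrow> 0 \<le> r (i, j)) \<Longrightarrow>
      (\<integral>\<^sup>+y. G (merge R S (r, y)) * indicator (slab S (s r) w) y \<partial>PiM S (\<lambda>_. lborel))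
      \<le> C * (\<integral>\<^sup>+y. H (merge R S (r, y)) * indicator (slab S (s r) w) y \<partial>PiM S (\<lambda>_. lborel))"
  shows "(\<integral>\<^sup>+c. G c * indicator (birkhoff N) c \<partial>corner_lborel N)
    \<le> C * (\<integral>\<^sup>+c. H c * indicator (birkhoff N) c \<partial>corner_lborel N)"
proof -
  let ?M = "\<lambda>I. PiM I (\<lambda>_. lborel :: real measure)"
  have I: "R \<union> S = {..<N} \<times> {..<N}" "R \<inter> S = {}" "finite R" "finite S" using k by (auto simp: R_def S_def)
  have M: "?M (R \<union> S) = corner_lborel N" by (simp add: I corner_lborel_def)
  interpret S: sigma_finite_measure "?M S" by (rule lborel_PiM.sigma_finite[OF I(4)])
  have fold: "(\<integral>\<^sup>+c. F c \<partial>corner_lborel N) = (\<integral>\<^sup>+r. (\<integral>\<^sup>+y. F (merge R S (r, y)) \<partial>?M S) \<partial>?M R)"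
    if "F \<in> borel_measurable (corner_lborel N)" for F
    using lborel_PiM.product_nn_integral_fold[OF I(2-4), of F] that by (simp add: M)
  have mrg: "merge R S \<in> measurable (?M R \<Otimes>\<^sub>M ?M S) (corner_lborel N)"
    using measurable_merge[of R S "\<lambda>_. lborel :: real measure"] by (simp add: M)
  have mrg1: "(\<lambda>y. merge R S (r, y)) \<in> measurable (?M S) (corner_lborel N)" if "r \<in> space (?M R)" for r
    using that by (intro measurable_compose[OF measurable_Pair mrg]) auto
  define ok where "ok r \<longleftrightarrow> (\<forall>i<N. i \<noteq> k \<longrightarrow> (\<forall>j<N. 0 \<le> r (i, j)) \<and> 0 \<le> 1 - (\<Sum>j<N. r (i, j) :: real))" for r
  \<comment> \<open>\<open>s r\<close> looks at the column index alone, so the row index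
    \<open>0\<close> is a placeholder.\<close>
  define w where "w r = 1 - (\<Sum>j<N. s r (0, j)) / 2" for r
  have ind: "indicator (birkhoff N) (merge R S (r, y)) = (if ok r then indicator (slab S (s r) (w r)) y else 0 :: ennreal)" for r y
    using merge_row_mem_birkhoff[OF k refl, of r y]
    by (auto simp: indicator_def ok_def R_def S_def s_def w_def)
  have H: "(\<integral>\<^sup>+y. C * (H (merge R S (r, y)) * indicator (birkhoff N) (merge R S (r, y))) \<partial>?M S)
     = C * (\<integral>\<^sup>+y. H (merge R S (r, y)) * indicator (birkhoff N) (merge R S (r, y)) \<partial>?M S)" if "r \<in> space (?M R)" for r
  proof -
    note [measurable] = mrg1[OF that]
    show ?thesis by (intro nn_integral_cmult) measurable
  qed
  have "(\<integral>\<^sup>+c. G c * indicator (birkhoff N) c \<partial>corner_lborel N)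
      = (\<integral>\<^sup>+r. (\<integral>\<^sup>+y. G (merge R S (r, y)) * indicator (birkhoff N) (merge R S (r, y)) \<partial>?M S) \<partial>?M R)"
    by (rule fold) measurable
  also have "\<dots> \<le> (\<integral>\<^sup>+r. (\<integral>\<^sup>+y. C * (H (merge R S (r, y)) * indicator (birkhoff N) (merge R S (r, y))) \<partial>?M S) \<partial>?M R)"
  proof (rule nn_integral_mono)
    fix r assume r: "r \<in> space (?M R)"
    show "(\<integral>\<^sup>+y. G (merge R S (r, y)) * indicator (birkhoff N) (merge R S (r, y)) \<partial>?M S) \<le>
        (\<integral>\<^sup>+y. C * (H (merge R S (r, y)) * indicator (birkhoff N) (merge R S (r, y))) \<partial>?M S)"
    proof (cases "ok r")
      case True
      then show ?thesis unfolding H[OF r] by (simp add: ind) (rule le, simp add: ok_def)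
    qed (simp add: ind)
  qed
  also have "\<dots> = (\<integral>\<^sup>+c. C * (H c * indicator (birkhoff N) c) \<partial>corner_lborel N)"
    by (rule fold[symmetric]) measurable
  also have "\<dots> = C * (\<integral>\<^sup>+c. H c * indicator (birkhoff N) c \<partial>corner_lborel N)"
    by (rule nn_integral_cmult) measurable
  finally show ?thesis .
qed

section \<open>Moment bounds\<close>

text \<open>Rows \<open>0\<close> and \<open>N\<close> are resampled. Given the others,
  \<open>X N 0\<close> is \<open>s - X 0 0\<close>, the factor gained in
  \<open>slab_moment_le\<close>.\<close>

lemma expectation_power_Suc_le:
  assumes N: "0 < N"
  shows "birkhoff_expectation N (\<lambda>X. X 0 0 ^ Suc p) \<le> 2 ^ (p + 3) * birkhoff_expectation N (\<lambda>X. X 0 0 ^ p * X N 0)"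
proof (rule birkhoff_expectation_leI)
  show "bounded_observable N (\<lambda>X. X 0 0 ^ Suc p)" "bounded_observable N (\<lambda>X. X 0 0 ^ p * X N 0)"
    by (intro observable)+
  show "(\<integral>\<^sup>+c. ennreal (fill N c 0 0 ^ Suc p) * indicator (birkhoff N) c \<partial>corner_lborel N)
    \<le> ennreal (2 ^ (p + 3)) * (\<integral>\<^sup>+c. ennreal (fill N c 0 0 ^ p * fill N c N 0) * indicator (birkhoff N) c \<partial>corner_lborel N)"
  proof (rule birkhoff_resample_row[OF N])
    fix r :: "nat \<times> nat \<Rightarrow> real" and w
    let ?R = "{..<N} \<times> {..<N} - {0} \<times> {..<N}" and ?S = "{0} \<times> {..<N}"
    let ?s = "\<lambda>p :: nat \<times> nat. 1 - (\<Sum>i\<in>{..<N} - {0}. r (i, snd p))"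
    have "fill N (merge ?R ?S (r, y)) 0 0 = y (0, 0)" "fill N (merge ?R ?S (r, y)) N 0 = ?s (0, 0) - y (0, 0)" for y
      using merge_row(3,4)[OF N refl] N by simp_all
    then show "(\<integral>\<^sup>+y. ennreal (fill N (merge ?R ?S (r, y)) 0 0 ^ Suc p) * indicator (slab ?S ?s w) y \<partial>PiM ?S (\<lambda>_. lborel))
      \<le> ennreal (2 ^ (p + 3)) * (\<integral>\<^sup>+y. ennreal (fill N (merge ?R ?S (r, y)) 0 0 ^ p * fill N (merge ?R ?S (r, y)) N 0)
          * indicator (slab ?S ?s w) y \<partial>PiM ?S (\<lambda>_. lborel))"
      using slab_moment_le[of ?S "(0, 0)" p ?s w] N by (simp only: ennreal_power[symmetric]) simp
  qed measurable
qed (auto intro!: birkhoff_nonneg mult_nonneg_nonneg zero_le_power)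

text \<open>Rows \<open>1\<close> and \<open>N\<close> are resampled, and the two factors of row
  \<open>0\<close> are constants. The sums of two products are the symmetric form in which negative
  correlation was proved; by exchangeability of the two rows each side is twice one moment.\<close>

lemma expectation_rectangle_swap:
  assumes N: "2 \<le> N"
  shows "birkhoff_expectation N (\<lambda>X. X 0 0 * X 0 1 * (X 1 0 * X 1 1 + X N 0 * X N 1))
    \<le> birkhoff_expectation N (\<lambda>X. X 0 0 * X 0 1 * (X 1 0 * X N 1 + X N 0 * X 1 1))"
proof -
  have "birkhoff_expectation N (\<lambda>X. X 0 0 * X 0 1 * (X 1 0 * X 1 1 + X N 0 * X N 1))
    \<le> 1 * birkhoff_expectation N (\<lambda>X. X 0 0 * X 0 1 * (X 1 0 * X N 1 + X N 0 * X 1 1))"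
  proof (rule birkhoff_expectation_leI)
    let ?G = "\<lambda>c. ennreal (fill N c 0 0 * fill N c 0 1 * (fill N c 1 0 * fill N c 1 1 + fill N c N 0 * fill N c N 1))"
    let ?H = "\<lambda>c. ennreal (fill N c 0 0 * fill N c 0 1 * (fill N c 1 0 * fill N c N 1 + fill N c N 0 * fill N c 1 1))"
    have k: "1 < N" using N by simp
    show "(\<integral>\<^sup>+c. ?G c * indicator (birkhoff N) c \<partial>corner_lborel N)
      \<le> ennreal 1 * (\<integral>\<^sup>+c. ?H c * indicator (birkhoff N) c \<partial>corner_lborel N)"
    proof (rule birkhoff_resample_row[OF k])
      fix r :: "nat \<times> nat \<Rightarrow> real" and w
      assume nn: "\<And>i j. i < N \<Longrightarrow> i \<noteq> 1 \<Longrightarrow> j < N \<Longrightarrow> 0 \<le> r (i, j)"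
      let ?R = "{..<N} \<times> {..<N} - {1} \<times> {..<N}" and ?S = "{1} \<times> {..<N}"
      let ?s = "\<lambda>p :: nat \<times> nat. 1 - (\<Sum>i\<in>{..<N} - {1}. r (i, snd p))"
      let ?M = "PiM ?S (\<lambda>_. lborel :: real measure)"
      let ?z = "r (0, 0) * r (0, 1)"
      have z: "0 \<le> ?z" using nn k by (intro mult_nonneg_nonneg) auto
      have e: "fill N (merge ?R ?S (r, y)) 0 0 = r (0, 0)" "fill N (merge ?R ?S (r, y)) 0 1 = r (0, 1)"
        "fill N (merge ?R ?S (r, y)) 1 0 = y (1, 0)" "fill N (merge ?R ?S (r, y)) 1 1 = y (1, 1)"
        "fill N (merge ?R ?S (r, y)) N 0 = ?s (1, 0) - y (1, 0)" "fill N (merge ?R ?S (r, y)) N 1 = ?s (1, 1) - y (1, 1)" for y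
        using k by (simp_all del: One_nat_def add: merge_row[OF k refl])
      have G: "?G (merge ?R ?S (r, y)) = ennreal ?z *
          ennreal (y (1, 0) * y (1, 1) + (?s (1, 0) - y (1, 0)) * (?s (1, 1) - y (1, 1)))"
        and H: "?H (merge ?R ?S (r, y)) = ennreal ?z *
          ennreal (y (1, 0) * (?s (1, 1) - y (1, 1)) + (?s (1, 0) - y (1, 0)) * y (1, 1))" for y
        unfolding ennreal_mult'[OF z, symmetric] e by simp_all
      note [measurable] = measurable_indicator_slab[of ?S, simplified]
      have comp[measurable]: "(\<lambda>y. y (1, 0)) \<in> borel_measurable ?M" "(\<lambda>y. y (1, 1)) \<in> borel_measurable ?M"
        using measurable_component_singleton[of "(1, 0)" ?S "\<lambda>_. lborel :: real measure"]
          measurable_component_singleton[of "(1, 1)" ?S "\<lambda>_. lborel :: real measure"] k by simp_all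
      have pull: "(\<integral>\<^sup>+y. ennreal ?z * F y * indicator (slab ?S ?s w) y \<partial>?M)
          = ennreal ?z * (\<integral>\<^sup>+y. F y * indicator (slab ?S ?s w) y \<partial>?M)" if [measurable]: "F \<in> borel_measurable ?M" for F
        unfolding mult.assoc by (rule nn_integral_cmult) (use measurable_indicator_slab[of ?S ?s w] in measurable)
      show "(\<integral>\<^sup>+y. ?G (merge ?R ?S (r, y)) * indicator (slab ?S ?s w) y \<partial>?M)
        \<le> ennreal 1 * (\<integral>\<^sup>+y. ?H (merge ?R ?S (r, y)) * indicator (slab ?S ?s w) y \<partial>?M)"
        unfolding G H
        by (subst (1 2) pull, measurable)
          (use slab_negative_correlation[of ?S "(1, 0)" "(1, 1)" ?s w] k in \<open>simp add: mult_left_mono\<close>)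
    qed measurable
  qed (auto intro!: birkhoff_nonneg mult_nonneg_nonneg add_nonneg_nonneg observable)
  then show ?thesis by simp
qed

lemma expectation_row_swap:
  assumes "k \<le> N" "bounded_observable N f"
  shows "birkhoff_expectation N (\<lambda>X. f (\<lambda>i. X (Transposition.transpose k N i))) = birkhoff_expectation N f"
proof -
  have "birkhoff_symmetry N (\<lambda>X i. X (Transposition.transpose k N i))"
    using assms(1) by (intro birkhoff_symmetry_row_permute permutes_swap_id) auto
  from birkhoff_expectation_symmetry[OF this assms(2)] show ?thesis .
qed

lemma expectation_permute:
  assumes "\<sigma> permutes {..N}" "\<tau> permutes {..N}" "bounded_observable N f"
  shows "birkhoff_expectation N (\<lambda>X. f (\<lambda>i j. X (\<sigma> i) (\<tau> j))) = birkhoff_expectation N f"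
  by (rule birkhoff_expectation_symmetry[OF birkhoff_symmetry_permute[OF assms(1,2)] assms(3)])

lemma expectation_entry_power:
  assumes "i \<le> N" "j \<le> N"
  shows "birkhoff_expectation N (\<lambda>X. X i j ^ p) = birkhoff_expectation N (\<lambda>X. X 0 0 ^ p)"
proof -
  have "bounded_observable N (\<lambda>X. X 0 0 ^ p)" by (intro observable)
  from expectation_permute[OF _ _ this, of "Transposition.transpose 0 i" "Transposition.transpose 0 j"] assms
  show ?thesis by (simp add: permutes_swap_id)
qed

text \<open>Summing over the rows \<open>a..N\<close>, which are exchangeable for \<open>f\<close>,
  turns the last factor into part of a column sum, which is at most \<open>1\<close>. Each
  application peels off one factor and gains the number of these rows.\<close>

lemma expectation_split_row_le:
  assumes N: "a \<le> N" and f: "bounded_observable N f" "\<And>c. c \<in> birkhoff N \<Longrightarrow> 0 \<le> f (fill N c)" and j: "j \<le> N"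
    and inv: "\<And>k X. a \<le> k \<Longrightarrow> k \<le> N \<Longrightarrow> f (\<lambda>i. X (Transposition.transpose k N i)) = f X"
  shows "real (Suc N - a) * birkhoff_expectation N (\<lambda>X. f X * X N j) \<le> birkhoff_expectation N f"
proof -
  let ?E = "birkhoff_expectation N"
  have eq: "?E (\<lambda>X. f X * X k j) = ?E (\<lambda>X. f X * X N j)" if "a \<le> k" "k \<le> N" for k
  proof -
    have "bounded_observable N (\<lambda>X. f X * X N j)" by (intro observable f)
    from expectation_row_swap[OF that(2) this] show ?thesis using inv[OF that] by simp
  qed
  have "real (Suc N - a) * ?E (\<lambda>X. f X * X N j) = (\<Sum>k=a..N. ?E (\<lambda>X. f X * X N j))"
    by simp
  also have "\<dots> = (\<Sum>k=a..N. ?E (\<lambda>X. f X * X k j))"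
    by (intro sum.cong refl eq[symmetric]) auto
  also have "\<dots> = ?E (\<lambda>X. \<Sum>k=a..N. f X * X k j)"
    by (subst birkhoff_expectation_sum) (auto intro: observable f)
  also have "\<dots> \<le> ?E f"
  proof (rule birkhoff_expectation_mono)
    fix c assume c: "c \<in> birkhoff N"
    have "(\<Sum>k=a..N. fill N c k j) \<le> (\<Sum>k\<le>N. fill N c k j)"
      using birkhoff_nonneg[OF c] by (intro sum_mono2) auto
    also have "\<dots> = 1" by (rule fill_col_sum[OF j])
    finally show "(\<Sum>k=a..N. f (fill N c) * fill N c k j) \<le> f (fill N c)"
      using f(2)[OF c] by (simp add: sum_distrib_left[symmetric] mult_left_le)
  qed (intro observable f)+
  finally show ?thesis .
qed

text \<open>Two moves alternate: \<open>expectation_power_Suc_le\<close> shifts one factor to row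
  \<open>N\<close>, and \<open>expectation_split_row_le\<close> peels it off for
  \<open>1 / N\<close>.\<close>

lemma expectation_power_le:
  assumes N: "0 < N" and "i \<le> N" "j \<le> N"
  shows "birkhoff_expectation N (\<lambda>X. X i j ^ p) \<le> 2 ^ (p * (p + 3)) / real N ^ p"
proof -
  let ?E = "birkhoff_expectation N"
  have "?E (\<lambda>X. X 0 0 ^ p) \<le> 2 ^ (p * (p + 3)) / real N ^ p"
  proof (induction p)
    case (Suc p)
    have inv: "X (Transposition.transpose k N 0) 0 ^ p = X 0 0 ^ p" if "1 \<le> k" "k \<le> N" for k and X :: "nat \<Rightarrow> nat \<Rightarrow> real"
      using that by (simp add: Transposition.transpose_def)
    have "real (Suc N - 1) * ?E (\<lambda>X. X 0 0 ^ p * X N 0) \<le> ?E (\<lambda>X. X 0 0 ^ p)"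
      using N inv by (intro expectation_split_row_le)
        (auto intro!: observable birkhoff_nonneg zero_le_power)
    then have "?E (\<lambda>X. X 0 0 ^ p * X N 0) \<le> ?E (\<lambda>X. X 0 0 ^ p) / N"
      using N by (simp add: field_simps)
    also have "\<dots> \<le> (2 ^ (p * (p + 3)) / real N ^ p) / N"
      by (intro divide_right_mono Suc.IH) simp
    finally have "2 ^ (p + 3) * ?E (\<lambda>X. X 0 0 ^ p * X N 0) \<le> 2 ^ (p + 3) * ((2 ^ (p * (p + 3)) / real N ^ p) / N)"
      by (rule mult_left_mono) simp
    with expectation_power_Suc_le[OF N, of p]
    have "?E (\<lambda>X. X 0 0 ^ Suc p) \<le> 2 ^ (p + 3) * ((2 ^ (p * (p + 3)) / real N ^ p) / N)" by linarith
    also have "\<dots> = 2 ^ (p + 3 + p * (p + 3)) / real N ^ Suc p" by (simp add: power_add)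
    \<comment> \<open>The increments \<open>q + 3\<close> for \<open>q < p\<close> add up to
      \<open>p * (p + 5) / 2\<close>; \<open>p * (p + 3)\<close> is a simpler upper bound that is
      stable under the induction.\<close>
    also have "\<dots> \<le> 2 ^ (Suc p * (Suc p + 3)) / real N ^ Suc p"
      by (intro divide_right_mono power_increasing) (auto simp: algebra_simps)
    finally show ?case .
  qed simp
  then show ?thesis unfolding expectation_entry_power[OF assms(2,3)] .
qed

lemma expectation_entry: assumes "i \<le> N" "j \<le> N"
  shows "birkhoff_expectation N (\<lambda>X. X i j) = 1 / Suc N"
proof -
  let ?E = "birkhoff_expectation N"
  have eq: "?E (\<lambda>X. X i j) = ?E (\<lambda>X. X 0 0)" if "i \<le> N" "j \<le> N" for i j
    using expectation_entry_power[OF that, of 1] by simp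
  have "real (Suc N) * ?E (\<lambda>X. X 0 0) = (\<Sum>j\<le>N. ?E (\<lambda>X. X 0 0))" by simp
  also have "\<dots> = (\<Sum>j\<le>N. ?E (\<lambda>X. X 0 j))" by (intro sum.cong refl eq[symmetric]) auto
  also have "\<dots> = ?E (\<lambda>X. \<Sum>j\<le>N. X 0 j)"
    by (subst birkhoff_expectation_sum) (auto intro: observable)
  also have "\<dots> = 1" by (simp add: birkhoff_expectation_def fill_row_sum uniform_birkhoff.prob_space[simplified])
  finally show ?thesis using eq[OF assms] by (simp add: field_simps)
qed

lemma obtain_permutation_pair:
  fixes u v N :: nat
  assumes "u \<le> N" "v \<le> N" "u \<noteq> v"
  obtains \<sigma> where "\<sigma> permutes {..N}" "\<sigma> 0 = u" "\<sigma> 1 = v"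
proof -
  let ?t = "Transposition.transpose"
  have "1 \<le> N" using assms by linarith
  moreover have "?t 0 u v \<le> N" using assms(1,2) by (auto simp: Transposition.transpose_def)
  \<comment> \<open>The inner swap sends \<open>1\<close> to the preimage of \<open>v\<close> under
    the outer swap and fixes \<open>0\<close>, because that preimage is not
    \<open>0\<close>.\<close>
  ultimately have "?t 0 u \<circ> ?t 1 (?t 0 u v) permutes {..N}"
    using assms(1) by (intro permutes_compose permutes_swap_id) auto
  moreover have "(?t 0 u \<circ> ?t 1 (?t 0 u v)) 0 = u" "(?t 0 u \<circ> ?t 1 (?t 0 u v)) 1 = v"
    using assms(3) by (cases "v = 0"; simp add: Transposition.transpose_def)+
  ultimately show ?thesis by (rule that)
qed

text \<open>Row \<open>1\<close> carries two factors of the rectangle, so no column sum removes just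
  one of them. Negative correlation replaces \<open>X 1 1\<close> by \<open>X N 1\<close>, after
  which one factor at a time is peeled off: over the rows \<open>2..N\<close>, then
  \<open>1..N\<close>, and after a transposition over \<open>1..N\<close> again. The remaining mean
  is \<open>1 / (N + 1)\<close>.\<close>

lemma expectation_rectangle_le:
  assumes N: "2 \<le> N" and "i \<le> N" "k \<le> N" "i \<noteq> k" "j \<le> N" "l \<le> N" "j \<noteq> l"
  shows "birkhoff_expectation N (\<lambda>X. X i j * X i l * (X k j * X k l))
    \<le> 1 / (real (N - 1) * real N * real N * real (Suc N))"
proof -
  let ?E = "birkhoff_expectation N" and ?t = "Transposition.transpose"
  note nn = birkhoff_nonneg mult_nonneg_nonneg
  let ?a = "?E (\<lambda>X. X 0 0 * X 0 1 * (X 1 0 * X 1 1))"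
  let ?b = "?E (\<lambda>X. X 0 0 * X 0 1 * (X 1 0 * X N 1))"
  have ab: "?a \<le> ?b"
  proof -
    have obs: "bounded_observable N (\<lambda>X. X 0 0 * X 0 1 * (X 1 0 * X 1 1))"
      "bounded_observable N (\<lambda>X. X 0 0 * X 0 1 * (X 1 0 * X N 1))" by (intro observable)+
    have "?E (\<lambda>X. X 0 0 * X 0 1 * (X N 0 * X N 1)) = ?a" "?E (\<lambda>X. X 0 0 * X 0 1 * (X N 0 * X 1 1)) = ?b"
      using expectation_row_swap[OF _ obs(1), of 1] expectation_row_swap[OF _ obs(2), of 1] N
      by (simp_all add: Transposition.transpose_def)
    moreover have "?E (\<lambda>X. X 0 0 * X 0 1 * (X 1 0 * X 1 1 + X N 0 * X N 1))
        = ?a + ?E (\<lambda>X. X 0 0 * X 0 1 * (X N 0 * X N 1))"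
      unfolding distrib_left by (intro birkhoff_expectation_add observable)
    moreover have "?E (\<lambda>X. X 0 0 * X 0 1 * (X 1 0 * X N 1 + X N 0 * X 1 1))
        = ?b + ?E (\<lambda>X. X 0 0 * X 0 1 * (X N 0 * X 1 1))"
      unfolding distrib_left by (intro birkhoff_expectation_add observable)
    ultimately show ?thesis using expectation_rectangle_swap[OF N] by linarith
  qed
  have t0: "?t k N 0 = 0" if "1 \<le> k" for k using that N by (simp add: Transposition.transpose_def)
  have t1: "?t k N 1 = 1" if "2 \<le> k" for k using that N by (simp add: Transposition.transpose_def)
  have "real (Suc N - 2) * ?E (\<lambda>X. X 0 0 * X 0 1 * X 1 0 * X N 1) \<le> ?E (\<lambda>X. X 0 0 * X 0 1 * X 1 0)"
    by (rule expectation_split_row_le) (use N t0 t1 in \<open>auto intro!: observable nn simp del: One_nat_def\<close>)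
  then have b: "real (N - 1) * ?b \<le> ?E (\<lambda>X. X 0 0 * X 0 1 * X 1 0)"
    using N by (simp add: mult.assoc Suc_diff_le numeral_2_eq_2)
  have c1: "?E (\<lambda>X. X 0 0 * X 0 1 * X 1 0) = ?E (\<lambda>X. X 0 0 * X 0 1 * X N 0)"
  proof -
    have obs: "bounded_observable N (\<lambda>X. X 0 0 * X 0 1 * X N 0)" by (intro observable)
    show ?thesis using expectation_row_swap[OF _ obs, of 1] N by (simp add: Transposition.transpose_def)
  qed
  have c2: "real N * ?E (\<lambda>X. X 0 0 * X 0 1 * X N 0) \<le> ?E (\<lambda>X. X 0 0 * X 0 1)"
  proof -
    have "real (Suc N - 1) * ?E (\<lambda>X. X 0 0 * X 0 1 * X N 0) \<le> ?E (\<lambda>X. X 0 0 * X 0 1)"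
      by (rule expectation_split_row_le) (use N t0 in \<open>auto intro!: observable nn simp del: One_nat_def\<close>)
    then show ?thesis by simp
  qed
  have c3: "?E (\<lambda>X. X 0 0 * X 0 1) = ?E (\<lambda>X. X 0 0 * X N 0)"
  proof -
    have "?E (\<lambda>X. X 0 0 * X 0 1) = ?E (\<lambda>X. X 0 0 * X 1 0)"
    proof -
      have obs: "bounded_observable N (\<lambda>X. X 0 0 * X 1 0)" by (intro observable)
      show ?thesis using birkhoff_expectation_symmetry[OF birkhoff_symmetry_transpose obs] by simp
    qed
    also have "\<dots> = ?E (\<lambda>X. X 0 0 * X N 0)"
    proof -
      have obs: "bounded_observable N (\<lambda>X. X 0 0 * X N 0)" by (intro observable)
      show ?thesis using expectation_row_swap[OF _ obs, of 1] N by (simp add: Transposition.transpose_def)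
    qed
    finally show ?thesis .
  qed
  have c4: "real N * ?E (\<lambda>X. X 0 0 * X N 0) \<le> ?E (\<lambda>X. X 0 0)"
  proof -
    have "real (Suc N - 1) * ?E (\<lambda>X. X 0 0 * X N 0) \<le> ?E (\<lambda>X. X 0 0)"
      by (rule expectation_split_row_le) (use N t0 in \<open>auto intro!: observable nn simp del: One_nat_def\<close>)
    then show ?thesis by simp
  qed
  have c5: "?E (\<lambda>X. X 0 0) = 1 / Suc N" by (rule expectation_entry) auto
  have "real N * (real N * ?E (\<lambda>X. X 0 0 * X 0 1 * X 1 0)) \<le> real N * ?E (\<lambda>X. X 0 0 * X 0 1)"
    unfolding c1 by (rule mult_left_mono[OF c2]) simp
  also have "\<dots> \<le> 1 / Suc N" unfolding c3 c5[symmetric] by (rule c4)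
  finally have "real N * (real N * ?E (\<lambda>X. X 0 0 * X 0 1 * X 1 0)) \<le> 1 / Suc N" .
  moreover have "real N * (real N * (real (N - 1) * ?a)) \<le> real N * (real N * ?E (\<lambda>X. X 0 0 * X 0 1 * X 1 0))"
    by (intro mult_left_mono order_trans[OF mult_left_mono[OF ab] b]) auto
  ultimately have fin: "real N * (real N * (real (N - 1) * ?a)) \<le> 1 / Suc N" by linarith
  have a: "?a \<le> 1 / (real (N - 1) * real N * real N * real (Suc N))"
  proof -
    have "?a * (real (N - 1) * real N * real N * real (Suc N)) \<le> 1"
      using fin by (simp add: pos_le_divide_eq ac_simps)
    moreover have "0 < real (N - 1) * real N * real N * real (Suc N)" using N by simp
    ultimately show ?thesis by (simp only: pos_le_divide_eq)
  qed
  obtain \<sigma> where \<sigma>: "\<sigma> permutes {..N}" "\<sigma> 0 = i" "\<sigma> 1 = k"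
    by (rule obtain_permutation_pair[OF assms(2,3,4)])
  obtain \<tau> where \<tau>: "\<tau> permutes {..N}" "\<tau> 0 = j" "\<tau> 1 = l"
    by (rule obtain_permutation_pair[OF assms(5,6,7)])
  have obs: "bounded_observable N (\<lambda>X. X 0 0 * X 0 1 * (X 1 0 * X 1 1))" by (intro observable)
  have "?E (\<lambda>X. X i j * X i l * (X k j * X k l)) = ?a"
    using expectation_permute[OF \<sigma>(1) \<tau>(1) obs] unfolding \<sigma> \<tau> .
  then show ?thesis using a by simp
qed

section \<open>Two steps suffice\<close>

text \<open>The sum of the fourth powers of the singular values of \<open>X\<close>. For a doubly
  stochastic \<open>X\<close> the constant vector accounts for exactly \<open>1\<close>.\<close>

definition gram_square :: "nat \<Rightarrow> (nat \<Rightarrow> nat \<Rightarrow> real) \<Rightarrow> real" where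
  "gram_square N X = (\<Sum>i\<le>N. \<Sum>k\<le>N. (\<Sum>j\<le>N. X i j * X k j)\<^sup>2)"

lemma bounded_observable_gram_square [observable]: "bounded_observable N (gram_square N)"
proof -
  have "bounded_observable N (\<lambda>X. \<Sum>i\<le>N. \<Sum>k\<le>N. (\<Sum>j\<le>N. X i j * X k j)\<^sup>2)"
    by (intro observable)
  then show ?thesis by (simp add: gram_square_def[abs_def])
qed

lemma mult4_le:
  fixes x y z w :: real
  shows "x * y * (z * w) \<le> (x ^ 4 + y ^ 4 + z ^ 4 + w ^ 4) / 4"
proof -
  have "x * y * (z * w) \<le> ((x * y)\<^sup>2 + (z * w)\<^sup>2) / 2"
    using sum_squares_bound[of "x * y" "z * w"] by simp
  moreover have "(x * y)\<^sup>2 \<le> (x ^ 4 + y ^ 4) / 2" "(z * w)\<^sup>2 \<le> (z ^ 4 + w ^ 4) / 2"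
    using sum_squares_bound[of "x\<^sup>2" "y\<^sup>2"] sum_squares_bound[of "z\<^sup>2" "w\<^sup>2"]
    by (simp_all add: power_mult_distrib)
  ultimately show ?thesis by argo
qed

text \<open>Meant for the degenerate patterns \<open>i = k\<close> or \<open>j = l\<close>: there
  are only order \<open>n^3\<close> of them, so a crude bound of order \<open>n^-4\<close> leaves a
  total of order \<open>1 / n\<close>.\<close>

lemma expectation_four_entries_le:
  assumes N: "0 < N" and le: "i \<le> N" "k \<le> N" "j \<le> N" "l \<le> N"
  shows "birkhoff_expectation N (\<lambda>X. X i j * X i l * (X k j * X k l)) \<le> 2 ^ 28 / real N ^ 4"
proof -
  let ?E = "birkhoff_expectation N"
  have "?E (\<lambda>X. X i j * X i l * (X k j * X k l))
      \<le> ?E (\<lambda>X. (1/4) * (X i j ^ 4 + X i l ^ 4 + X k j ^ 4 + X k l ^ 4))"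
  proof (intro birkhoff_expectation_mono observable)
    fix c
    show "fill N c i j * fill N c i l * (fill N c k j * fill N c k l)
        \<le> (1/4) * (fill N c i j ^ 4 + fill N c i l ^ 4 + fill N c k j ^ 4 + fill N c k l ^ 4)"
      using mult4_le[of "fill N c i j" "fill N c i l" "fill N c k j" "fill N c k l"] by linarith
  qed
  also have "\<dots> = (1/4) * (?E (\<lambda>X. X i j ^ 4) + ?E (\<lambda>X. X i l ^ 4) + ?E (\<lambda>X. X k j ^ 4) + ?E (\<lambda>X. X k l ^ 4))"
    by (simp only: birkhoff_expectation_cmult birkhoff_expectation_add observable)
  also have "\<dots> \<le> 2 ^ 28 / real N ^ 4"
    using expectation_power_le[OF N le(1,3), of 4] expectation_power_le[OF N le(1,4), of 4]
      expectation_power_le[OF N le(2,3), of 4] expectation_power_le[OF N le(2,4), of 4] by simp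
  finally show ?thesis .
qed

text \<open>The \<open>((N + 1) * N)^2\<close> genuine rectangles contribute
  \<open>(N + 1) / (N - 1)\<close>. Here the leading constant must be exactly \<open>1\<close>,
  which is why they need the sharp bound of \<open>expectation_rectangle_le\<close>.\<close>

lemma expectation_gram_square_le:
  assumes N: "2 \<le> N"
  shows "birkhoff_expectation N (gram_square N) \<le>
    real (Suc N) / real (N - 1) + 2 * real (Suc N) ^ 3 * (2 ^ 28 / real N ^ 4)"
proof -
  let ?E = "birkhoff_expectation N"
  define A where "A = 1 / (real (N - 1) * real N * real N * real (Suc N))"
  define B :: real where "B = 2 ^ 28 / real N ^ 4"
  have AB: "0 \<le> A" "0 \<le> B" by (auto simp: A_def B_def)
  \<comment> \<open>Terms in \<open>(i, k)\<close> alone, in \<open>(j, l)\<close> alone, and a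
    product of both let the fourfold sum factorize. Patterns with \<open>i = k\<close> and
    \<open>j = l\<close> are counted twice, harmless for an upper bound.\<close>
  define d e :: "nat \<Rightarrow> nat \<Rightarrow> real"
    where "d i k = (if i = k then 0 else 1)" and "e i k = (if i = k then B else 0)" for i k
  define b :: "nat \<Rightarrow> nat \<Rightarrow> nat \<Rightarrow> nat \<Rightarrow> real"
    where "b i k j l = e i k + e j l + A * (d i k * d j l)"
    for i k j l
  have expand: "gram_square N X = (\<Sum>i\<le>N. \<Sum>k\<le>N. \<Sum>j\<le>N. \<Sum>l\<le>N. X i j * X i l * (X k j * X k l))" for X
    unfolding gram_square_def power2_eq_square sum_product by (intro sum.cong refl) (simp only: ac_simps)
  have "?E (gram_square N) = ?E (\<lambda>X. \<Sum>i\<le>N. \<Sum>k\<le>N. \<Sum>j\<le>N. \<Sum>l\<le>N. X i j * X i l * (X k j * X k l))"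
    by (simp add: expand[abs_def])
  also have "\<dots> = (\<Sum>i\<le>N. \<Sum>k\<le>N. \<Sum>j\<le>N. \<Sum>l\<le>N. ?E (\<lambda>X. X i j * X i l * (X k j * X k l)))"
    by (simp add: birkhoff_expectation_sum observable)
  also have "\<dots> \<le> (\<Sum>i\<le>N. \<Sum>k\<le>N. \<Sum>j\<le>N. \<Sum>l\<le>N. b i k j l)"
  proof (intro sum_mono)
    fix i k j l assume "i \<in> {..N}" "k \<in> {..N}" "j \<in> {..N}" "l \<in> {..N}"
    then have le: "i \<le> N" "k \<le> N" "j \<le> N" "l \<le> N" by auto
    show "?E (\<lambda>X. X i j * X i l * (X k j * X k l)) \<le> b i k j l"
    proof (cases "i = k \<or> j = l")
      case True
      have "?E (\<lambda>X. X i j * X i l * (X k j * X k l)) \<le> B"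
        unfolding B_def by (rule expectation_four_entries_le) (use N le in auto)
      then show ?thesis using True AB by (auto simp: b_def d_def e_def)
    next
      case False
      then show ?thesis using expectation_rectangle_le[OF N le(1,2) _ le(3,4)] by (simp add: b_def d_def e_def A_def)
    qed
  qed
  also have "\<dots> = 2 * real (Suc N) ^ 3 * B + A * (real (Suc N) * real N) ^ 2"
  proof -
    have "(\<Sum>k\<le>N. d i k) = real N" if "i \<le> N" for i
    proof -
      have "(\<Sum>k\<le>N. d i k) = (\<Sum>k\<le>N. 1 - (if i = k then 1 else 0))"
        by (intro sum.cong) (auto simp: d_def)
      then show ?thesis using that by (simp add: sum_subtractf)
    qed
    then have sd: "(\<Sum>i\<le>N. \<Sum>k\<le>N. d i k) = real (Suc N) * real N" by simp
    have se: "(\<Sum>i\<le>N. \<Sum>k\<le>N. e i k) = real (Suc N) * B" by (simp add: e_def)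
    have "(\<Sum>i\<le>N. \<Sum>k\<le>N. \<Sum>j\<le>N. \<Sum>l\<le>N. b i k j l) =
      (\<Sum>i\<le>N. \<Sum>k\<le>N. real (Suc N) * (real (Suc N) * e i k) + real (Suc N) * B + A * (d i k * (real (Suc N) * real N)))"
      by (simp only: b_def sum.distrib sum_distrib_left[symmetric] sd se sum_constant card_atMost)
    also have "\<dots> = real (Suc N) * (real (Suc N) * (real (Suc N) * B)) + real (Suc N) * (real (Suc N) * (real (Suc N) * B))
        + A * (real (Suc N) * real N * (real (Suc N) * real N))"
      by (simp only: sum.distrib sum_distrib_left[symmetric] sum_distrib_right[symmetric] sd se sum_constant card_atMost)
    finally show ?thesis by (simp add: power3_eq_cube power2_eq_square)
  qed
  also have "A * (real (Suc N) * real N) ^ 2 = real (Suc N) / real (N - 1)"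
  proof -
    have "A * (real (Suc N) * real N) ^ 2 = (real N * real N * real (Suc N) * real (Suc N)) / (real N * real N * real (Suc N) * real (N - 1))"
      by (simp only: A_def power2_eq_square) (simp only: times_divide_eq_left times_divide_eq_right mult_1 mult_1_right ac_simps)
    then show ?thesis using N by (simp del: of_nat_Suc)
  qed
  finally show ?thesis by (simp add: B_def)
qed

text \<open>The deviation of row \<open>i\<close> of the square is \<open>v = D X\<close>, with
  \<open>D\<close> the deviation of row \<open>i\<close> of \<open>X\<close>. Its squared Euclidean
  norm is the quadratic form of \<open>G = X X^T\<close> at \<open>D\<close>, at most the squared
  norm of \<open>D\<close> times the Hilbert-Schmidt norm of \<open>H\<close>, the difference of
  \<open>G\<close> and the constant matrix. The squared norm of \<open>D\<close> is at most
  \<open>u\<close>, and passing from the squared Euclidean to the squared \<open>L^1\<close> norm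
  costs \<open>n\<close>.\<close>

lemma two_step_distance_le:
  fixes X :: "nat \<Rightarrow> nat \<Rightarrow> real"
  assumes nonneg: "\<And>k. 0 \<le> X i k" and le: "\<And>k. k \<le> N \<Longrightarrow> X i k \<le> u"
    and row: "\<And>i. i \<le> N \<Longrightarrow> (\<Sum>j\<le>N. X i j) = 1" and col: "\<And>j. j \<le> N \<Longrightarrow> (\<Sum>i\<le>N. X i j) = 1" and i: "i \<le> N"
  shows "(\<Sum>j\<le>N. \<bar>1 / real (Suc N) - (\<Sum>k\<le>N. X i k * X k j)\<bar>) ^ 4 \<le> (real (Suc N) * u)\<^sup>2 * (gram_square N X - 1)"
proof -
  define n where "n = real (Suc N)"
  have n: "0 < n" and card: "(\<Sum>k\<le>N. a) = n * a" for a :: real by (auto simp: n_def)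
  define D where "D k = X i k - 1 / n" for k
  define v where "v j = (\<Sum>k\<le>N. D k * X k j)" for j
  define G where "G k l = (\<Sum>j\<le>N. X k j * X l j)" for k l
  define H where "H p = G (fst p) (snd p) - 1 / n" for p
  let ?P = "{..N} \<times> {..N}"
  have D0: "(\<Sum>k\<le>N. D k) = 0" using row[OF i] n by (simp add: D_def sum_subtractf card del: sum_constant)
  have v: "v j = (\<Sum>k\<le>N. X i k * X k j) - 1 / n" if "j \<le> N" for j
    using col[OF that] by (simp add: v_def D_def left_diff_distrib sum_subtractf sum_divide_distrib[symmetric])
  have pair: "(\<Sum>k\<le>N. \<Sum>l\<le>N. F k l) = (\<Sum>p\<in>?P. F (fst p) (snd p))" for F :: "nat \<Rightarrow> nat \<Rightarrow> real"
    by (simp add: sum.cartesian_product case_prod_unfold)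
  \<comment> \<open>As \<open>D\<close> sums to \<open>0\<close>, subtracting a constant from
    \<open>G\<close> does not change its quadratic form at \<open>D\<close>; this lets
    \<open>H\<close> replace \<open>G\<close>.\<close>
  have DD: "(\<Sum>p\<in>?P. D (fst p) * D (snd p) * c) = 0" for c
  proof -
    have "(\<Sum>p\<in>?P. D (fst p) * D (snd p) * c) = (\<Sum>k\<le>N. D k) * (\<Sum>l\<le>N. D l) * c"
      unfolding pair[of "\<lambda>k l. D k * D l * c", symmetric] by (simp only: sum_product) (simp only: sum_distrib_right)
    then show ?thesis by (simp add: D0)
  qed
  have "(\<Sum>j\<le>N. (v j)\<^sup>2) = (\<Sum>j\<le>N. \<Sum>k\<le>N. \<Sum>l\<le>N. D k * D l * (X k j * X l j))"
    unfolding v_def power2_eq_square sum_product by (intro sum.cong refl) (simp only: ac_simps)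
  also have "\<dots> = (\<Sum>k\<le>N. \<Sum>l\<le>N. \<Sum>j\<le>N. D k * D l * (X k j * X l j))"
    by (subst sum.swap, subst (2) sum.swap) (rule refl)
  also have "\<dots> = (\<Sum>k\<le>N. \<Sum>l\<le>N. D k * D l * G k l)"
    by (simp only: G_def sum_distrib_left)
  also have "\<dots> = (\<Sum>p\<in>?P. D (fst p) * D (snd p) * G (fst p) (snd p))"
    by (rule pair)
  also have "\<dots> = (\<Sum>p\<in>?P. D (fst p) * D (snd p) * H p)"
    using DD[of "1 / n"] by (simp add: H_def right_diff_distrib sum_subtractf)
  finally have sv: "(\<Sum>j\<le>N. (v j)\<^sup>2) = (\<Sum>p\<in>?P. D (fst p) * D (snd p) * H p)" .
  have DDsq: "(\<Sum>p\<in>?P. (D (fst p) * D (snd p))\<^sup>2) = (\<Sum>k\<le>N. (D k)\<^sup>2)\<^sup>2"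
    by (simp add: power_mult_distrib power2_eq_square[of "sum _ _"] sum_product sum.cartesian_product case_prod_unfold)
  have GG: "(\<Sum>p\<in>?P. G (fst p) (snd p)) = n"
  proof -
    have "(\<Sum>p\<in>?P. G (fst p) (snd p)) = (\<Sum>k\<le>N. \<Sum>l\<le>N. \<Sum>j\<le>N. X k j * X l j)"
      using pair[of G] by (simp only: G_def)
    also have "\<dots> = (\<Sum>j\<le>N. \<Sum>k\<le>N. \<Sum>l\<le>N. X k j * X l j)"
      by (subst (2) sum.swap, subst sum.swap) (rule refl)
    also have "\<dots> = (\<Sum>j\<le>N. (\<Sum>k\<le>N. X k j) * (\<Sum>l\<le>N. X l j))" by (simp add: sum_product)
    also have "\<dots> = n" using col by (simp add: n_def)
    finally show ?thesis .
  qed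
  have HH: "(\<Sum>p\<in>?P. (H p)\<^sup>2) = gram_square N X - 1"
  proof -
    have "(\<Sum>p\<in>?P. (H p)\<^sup>2) = (\<Sum>p\<in>?P. (G (fst p) (snd p))\<^sup>2) - 2 / n * (\<Sum>p\<in>?P. G (fst p) (snd p)) + (\<Sum>p\<in>?P. (1 / n)\<^sup>2)"
    proof -
      have "(H p)\<^sup>2 = (G (fst p) (snd p))\<^sup>2 - 2 / n * G (fst p) (snd p) + (1 / n)\<^sup>2" for p
        by (simp add: H_def power2_diff)
      then show ?thesis by (simp only: sum.distrib sum_subtractf sum_distrib_left)
    qed
    also have "(\<Sum>p\<in>?P. (1 / n)\<^sup>2) = 1"
    proof -
      have "real (card ?P) = n * n" by (simp only: card_cartesian_product card_atMost n_def of_nat_mult)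
      then show ?thesis using n by (simp add: power2_eq_square del: card_cartesian_product)
    qed
    also have "(\<Sum>p\<in>?P. (G (fst p) (snd p))\<^sup>2) = gram_square N X"
      by (simp only: gram_square_def G_def pair)
    finally show ?thesis using n GG by simp
  qed
  have "(\<Sum>k\<le>N. (D k)\<^sup>2) = (\<Sum>k\<le>N. (X i k)\<^sup>2) - 2 / n * (\<Sum>k\<le>N. X i k) + (\<Sum>k\<le>N. (1 / n)\<^sup>2)"
  proof -
    have "(D k)\<^sup>2 = (X i k)\<^sup>2 - 2 / n * X i k + (1 / n)\<^sup>2" for k
      by (simp add: D_def power2_diff)
    then show ?thesis by (simp only: sum.distrib sum_subtractf sum_distrib_left)
  qed
  also have "\<dots> = (\<Sum>k\<le>N. (X i k)\<^sup>2) - 1 / n"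
    using row[OF i] n by (simp add: card power2_eq_square del: sum_constant)
  also have "\<dots> \<le> (\<Sum>k\<le>N. (X i k)\<^sup>2)" using n by simp
  also have "\<dots> \<le> (\<Sum>k\<le>N. u * X i k)"
    using le nonneg by (intro sum_mono) (simp add: power2_eq_square mult_right_mono)
  also have "\<dots> = u" using row[OF i] by (simp add: sum_distrib_left[symmetric])
  finally have Du: "(\<Sum>k\<le>N. (D k)\<^sup>2) \<le> u" .
  have D2: "0 \<le> (\<Sum>k\<le>N. (D k)\<^sup>2)" by (intro sum_nonneg) auto
  have "(\<Sum>j\<le>N. \<bar>v j\<bar>)\<^sup>2 \<le> (\<Sum>j\<le>N. 1\<^sup>2) * (\<Sum>j\<le>N. \<bar>v j\<bar>\<^sup>2)"
    using Cauchy_Schwarz_ineq_sum[of "\<lambda>_. 1" "\<lambda>j. \<bar>v j\<bar>" "{..N}"] by simp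
  then have "(\<Sum>j\<le>N. \<bar>v j\<bar>)\<^sup>2 \<le> n * (\<Sum>j\<le>N. (v j)\<^sup>2)" by (simp add: n_def)
  then have "((\<Sum>j\<le>N. \<bar>v j\<bar>)\<^sup>2)\<^sup>2 \<le> (n * (\<Sum>j\<le>N. (v j)\<^sup>2))\<^sup>2" by (intro power_mono) auto
  also have "\<dots> = n\<^sup>2 * (\<Sum>p\<in>?P. D (fst p) * D (snd p) * H p)\<^sup>2" by (simp add: sv power_mult_distrib)
  also have "\<dots> \<le> n\<^sup>2 * ((\<Sum>p\<in>?P. (D (fst p) * D (snd p))\<^sup>2) * (\<Sum>p\<in>?P. (H p)\<^sup>2))"
    by (intro mult_left_mono Cauchy_Schwarz_ineq_sum) auto
  also have "\<dots> \<le> n\<^sup>2 * (u\<^sup>2 * (gram_square N X - 1))"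
    unfolding DDsq HH[symmetric] using Du D2
    by (intro mult_left_mono mult_right_mono power_mono sum_nonneg) auto
  finally have "(\<Sum>j\<le>N. \<bar>v j\<bar>) ^ 4 \<le> (n * u)\<^sup>2 * (gram_square N X - 1)"
    by (simp add: power_mult_distrib mult.assoc flip: power_mult)
  moreover have "(\<Sum>j\<le>N. \<bar>v j\<bar>) = (\<Sum>j\<le>N. \<bar>1 / n - (\<Sum>k\<le>N. X i k * X k j)\<bar>)"
    using v by (intro sum.cong) (auto simp: abs_minus_commute)
  ultimately show ?thesis by (simp add: n_def)
qed

text \<open>With the trivial bound \<open>u = 1\<close>, the right-hand side of
  \<open>two_step_distance_le\<close> is a positive multiple of \<open>gram_square - 1\<close>, and
  the left-hand side is a fourth power. Markov's inequality needs this sign.\<close>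

lemma gram_square_ge_1:
  assumes "c \<in> birkhoff N"
  shows "1 \<le> gram_square N (fill N c)"
proof -
  have "0 \<le> (\<Sum>j\<le>N. \<bar>1 / real (Suc N) - (\<Sum>k\<le>N. fill N c 0 k * fill N c k j)\<bar>) ^ 4" by simp
  also have "\<dots> \<le> (real (Suc N) * 1)\<^sup>2 * (gram_square N (fill N c) - 1)"
    using birkhoff_nonneg[OF assms] birkhoff_le_1[OF assms] fill_row_sum fill_col_sum
    by (intro two_step_distance_le) auto
  finally show ?thesis by (simp add: zero_le_mult_iff)
qed

lemma birkhoff_Markov:
  assumes f: "bounded_observable N f" "\<And>c. c \<in> birkhoff N \<Longrightarrow> 0 \<le> f (fill N c)" and a: "0 < a"
  shows "measure (uniform_birkhoff N) {c \<in> space (corner_lborel N). a \<le> f (fill N c)} \<le> birkhoff_expectation N f / a"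
  using integral_Markov_inequality_measure[of "uniform_birkhoff N" "\<lambda>c. f (fill N c)" "space (corner_lborel N)" a]
    bounded_observable_integrable[OF f(1)] AE_uniform_birkhoffI[of N "\<lambda>c. 0 \<le> f (fill N c)"] f(2) a
  by (simp add: birkhoff_expectation_def)

text \<open>If no entry of the row exceeds \<open>K / n\<close>, then
  \<open>two_step_distance_le\<close> with \<open>u = K / n\<close> shows that a far row forces a
  large \<open>gram_square\<close>. Hence two Markov bounds suffice: sixth moments with a union over
  all entries, and the mean of \<open>gram_square - 1\<close>.\<close>

lemma two_step_far_prob_le:
  assumes N: "2 \<le> N" and \<epsilon>: "0 < \<epsilon>" and K: "0 < K"
  shows "measure (uniform_birkhoff N) {c \<in> space (corner_lborel N). \<exists>i\<le>N.
      \<epsilon> < 1/2 * (\<Sum>j\<le>N. \<bar>1 / real (Suc N) - (\<Sum>k\<le>N. fill N c i k * fill N c k j)\<bar>)}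
    \<le> (real (Suc N))\<^sup>2 * (2 ^ 54 / real N ^ 6 / (K / real (Suc N)) ^ 6)
      + (real (Suc N) / real (N - 1) + 2 * real (Suc N) ^ 3 * (2 ^ 28 / real N ^ 4) - 1) / (16 * \<epsilon> ^ 4 / K\<^sup>2)"
    (is "measure ?U ?F \<le> _")
proof -
  let ?M = "corner_lborel N"
  define n where "n = real (Suc N)"
  have n: "0 < n" by (simp add: n_def)
  define T where "T p = {c \<in> space ?M. (K / n) ^ 6 \<le> fill N c (fst p) (snd p) ^ 6}" for p
  \<comment> \<open>The threshold is the \<open>x\<close> with
    \<open>(2 * \<epsilon>)^4 = K^2 * x\<close>.\<close>
  define S where "S = {c \<in> space ?M. 16 * \<epsilon> ^ 4 / K\<^sup>2 \<le> gram_square N (fill N c) - 1}"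
  let ?P = "{..N} \<times> {..N}"
  have [measurable]: "(\<lambda>c. gram_square N (fill N c)) \<in> borel_measurable ?M"
    by (rule bounded_observable_measurable) (intro observable)
  have T[measurable]: "T p \<in> sets ?M" for p unfolding T_def by measurable
  have S[measurable]: "S \<in> sets ?M" unfolding S_def by measurable
  have "AE c in ?U. c \<in> ?F \<longrightarrow> c \<in> (\<Union>p\<in>?P. T p) \<union> S"
  proof (intro AE_uniform_birkhoffI impI)
    fix c assume c: "c \<in> birkhoff N" and F: "c \<in> ?F"
    have sp: "c \<in> space ?M" using F by simp
    obtain i where i: "i \<le> N" and far: "\<epsilon> < 1/2 * (\<Sum>j\<le>N. \<bar>1 / n - (\<Sum>k\<le>N. fill N c i k * fill N c k j)\<bar>)"
      using F by (auto simp: n_def)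
    show "c \<in> (\<Union>p\<in>?P. T p) \<union> S"
    proof (cases "\<exists>k\<le>N. K / n < fill N c i k")
      case True
      then obtain k where k: "k \<le> N" "K / n < fill N c i k" by blast
      then have "(K / n) ^ 6 \<le> fill N c i k ^ 6" using n K by (intro power_mono) auto
      then have "c \<in> T (i, k)" using sp by (simp add: T_def)
      then show ?thesis using i k by blast
    next
      case False
      have "(2 * \<epsilon>) ^ 4 \<le> (\<Sum>j\<le>N. \<bar>1 / n - (\<Sum>k\<le>N. fill N c i k * fill N c k j)\<bar>) ^ 4"
        using far \<epsilon> by (intro power_mono) auto
      also have "\<dots> \<le> (n * (K / n))\<^sup>2 * (gram_square N (fill N c) - 1)"
        unfolding n_def by (rule two_step_distance_le)
          (use False i birkhoff_nonneg[OF c] fill_row_sum fill_col_sum in \<open>auto simp: n_def not_less\<close>)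
      finally have "16 * \<epsilon> ^ 4 \<le> K\<^sup>2 * (gram_square N (fill N c) - 1)"
        using n by (simp add: power_mult_distrib)
      then have "c \<in> S" using K sp by (simp add: S_def pos_divide_le_eq mult.commute)
      then show ?thesis by blast
    qed
  qed
  then have "measure ?U ?F \<le> measure ?U ((\<Union>p\<in>?P. T p) \<union> S)"
    by (intro uniform_birkhoff.finite_measure_mono_AE) (auto simp: case_prod_beta)
  also have "\<dots> \<le> measure ?U (\<Union>p\<in>?P. T p) + measure ?U S"
    by (intro measure_Un_le) auto
  also have "\<dots> \<le> (\<Sum>p\<in>?P. measure ?U (T p)) + measure ?U S"
    by (intro add_mono uniform_birkhoff.finite_measure_subadditive_finite) auto
  also have "\<dots> \<le> (\<Sum>p\<in>?P. 2 ^ 54 / real N ^ 6 / (K / n) ^ 6)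
      + (real (Suc N) / real (N - 1) + 2 * real (Suc N) ^ 3 * (2 ^ 28 / real N ^ 4) - 1) / (16 * \<epsilon> ^ 4 / K\<^sup>2)"
  proof (intro add_mono sum_mono)
    fix p assume p: "p \<in> ?P"
    have "measure ?U (T p) \<le> birkhoff_expectation N (\<lambda>X. X (fst p) (snd p) ^ 6) / (K / n) ^ 6"
      unfolding T_def using n K by (intro birkhoff_Markov observable) (auto intro: birkhoff_nonneg)
    also have "\<dots> \<le> 2 ^ 54 / real N ^ 6 / (K / n) ^ 6"
      using expectation_power_le[of N "fst p" "snd p" 6] p N n K by (intro divide_right_mono) auto
    finally show "measure ?U (T p) \<le> 2 ^ 54 / real N ^ 6 / (K / n) ^ 6" .
  next
    have "measure ?U S \<le> birkhoff_expectation N (\<lambda>X. gram_square N X - 1) / (16 * \<epsilon> ^ 4 / K\<^sup>2)"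
      unfolding S_def using \<epsilon> K gram_square_ge_1 by (intro birkhoff_Markov observable) auto
    also have "birkhoff_expectation N (\<lambda>X. gram_square N X - 1) = birkhoff_expectation N (gram_square N) - 1"
      by (simp add: birkhoff_expectation_diff observable)
    also have "(birkhoff_expectation N (gram_square N) - 1) / (16 * \<epsilon> ^ 4 / K\<^sup>2) \<le>
        (real (Suc N) / real (N - 1) + 2 * real (Suc N) ^ 3 * (2 ^ 28 / real N ^ 4) - 1) / (16 * \<epsilon> ^ 4 / K\<^sup>2)"
      using expectation_gram_square_le[OF N] \<epsilon> K by (intro divide_right_mono) auto
    finally show "measure ?U S \<le> (real (Suc N) / real (N - 1) + 2 * real (Suc N) ^ 3 * (2 ^ 28 / real N ^ 4) - 1) / (16 * \<epsilon> ^ 4 / K\<^sup>2)" .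
  qed
  finally show ?thesis
    by (simp only: n_def sum_constant card_cartesian_product card_atMost of_nat_mult power2_eq_square)
qed

section \<open>One step does not suffice\<close>

text \<open>Two one-sided exponential densities of mass \<open>1\<close>, overlapping only at
  \<open>t = a\<close>, dominate the two-sided exponential.\<close>

lemma nn_integral_exp_abs_le:
  fixes l a :: real
  assumes l: "0 < l"
  shows "(\<integral>\<^sup>+t. ennreal (exp (- l * \<bar>t - a\<bar>)) \<partial>lborel) \<le> ennreal (2 / l)"
proof -
  let ?d = "\<lambda>t. ennreal (exponential_density l t)"
  have dens: "(\<integral>\<^sup>+t. ?d t \<partial>lborel) = 1"
    using prob_space.emeasure_space_1[OF prob_space_exponential_density[OF l]] by (simp add: emeasure_density)
  have [measurable]: "?d \<in> borel_measurable borel" by measurable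
  have "(\<integral>\<^sup>+t. ennreal (exp (- l * \<bar>t - a\<bar>)) \<partial>lborel)
      \<le> (\<integral>\<^sup>+t. ennreal (1 / l) * (?d (- a + t) + ?d (a - t)) \<partial>lborel)"
  proof (rule nn_integral_mono)
    fix t
    have "exp (- l * \<bar>t - a\<bar>) \<le> 1 / l * (exponential_density l (- a + t) + exponential_density l (a - t))"
      using l by (auto simp: exponential_density_def abs_if field_simps)
    then have "ennreal (exp (- l * \<bar>t - a\<bar>)) \<le> ennreal (1 / l * (exponential_density l (- a + t) + exponential_density l (a - t)))"
      by (rule ennreal_leI)
    also have "\<dots> = ennreal (1 / l) * (?d (- a + t) + ?d (a - t))"
      using l exponential_density_nonneg[OF l] by (simp only: ennreal_mult ennreal_plus divide_nonneg_nonneg add_nonneg_nonneg less_imp_le zero_le_one)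
    finally show "ennreal (exp (- l * \<bar>t - a\<bar>)) \<le> ennreal (1 / l) * (?d (- a + t) + ?d (a - t))" .
  qed
  also have "\<dots> = ennreal (1 / l) * ((\<integral>\<^sup>+t. ?d (- a + t) \<partial>lborel) + (\<integral>\<^sup>+t. ?d (a - t) \<partial>lborel))"
    by (simp add: nn_integral_cmult nn_integral_add)
  also have "\<dots> = ennreal (1 / l) * 2"
    using nn_integral_lborel_translate[of ?d "- a"] nn_integral_lborel_reflect[of ?d a] dens by simp
  also have "\<dots> = ennreal (2 / l)"
    using l by (metis ennreal_mult' ennreal_numeral mult.commute times_divide_eq_right mult_1_right zero_le_numeral)
  finally show ?thesis .
qed

text \<open>Chernoff: the indicator of the ball is at most \<open>exp (l * (R - \<Sum>\<bar>c p - a\<bar>))\<close>, which factorizes.\<close>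

lemma emeasure_L1_ball_le:
  fixes a l R :: real
  assumes I: "finite I" and l: "0 < l" and A: "A \<in> sets (PiM I (\<lambda>_. lborel))"
    and R: "\<And>c. c \<in> A \<Longrightarrow> (\<Sum>p\<in>I. \<bar>c p - a\<bar>) \<le> R"
  shows "emeasure (PiM I (\<lambda>_. lborel)) A \<le> ennreal (exp (l * R) * (2 / l) ^ card I)"
proof -
  let ?M = "PiM I (\<lambda>_. lborel :: real measure)"
  have "emeasure ?M A = (\<integral>\<^sup>+c. indicator A c \<partial>?M)" using A by simp
  also have "\<dots> \<le> (\<integral>\<^sup>+c. ennreal (exp (l * R)) * (\<Prod>p\<in>I. ennreal (exp (- l * \<bar>c p - a\<bar>))) \<partial>?M)"
  proof (rule nn_integral_mono)
    fix c
    have "(\<Prod>p\<in>I. ennreal (exp (- l * \<bar>c p - a\<bar>))) = ennreal (exp (- l * (\<Sum>p\<in>I. \<bar>c p - a\<bar>)))"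
      by (simp add: prod_ennreal exp_sum[OF I, symmetric] sum_distrib_left sum_negf)
    then have eq: "ennreal (exp (l * R)) * (\<Prod>p\<in>I. ennreal (exp (- l * \<bar>c p - a\<bar>)))
        = ennreal (exp (l * (R - (\<Sum>p\<in>I. \<bar>c p - a\<bar>))))"
      by (simp add: ennreal_mult[symmetric] exp_add[symmetric] algebra_simps)
    show "indicator A c \<le> ennreal (exp (l * R)) * (\<Prod>p\<in>I. ennreal (exp (- l * \<bar>c p - a\<bar>)))"
      unfolding eq using R[of c] l by (auto simp: indicator_def)
  qed
  also have "\<dots> = ennreal (exp (l * R)) * (\<Prod>p\<in>I. (\<integral>\<^sup>+t. ennreal (exp (- l * \<bar>t - a\<bar>)) \<partial>lborel))"
    using lborel_PiM.product_nn_integral_prod[OF I, of "\<lambda>_ t. ennreal (exp (- l * \<bar>t - a\<bar>))"]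
    by (subst nn_integral_cmult) auto
  also have "\<dots> \<le> ennreal (exp (l * R)) * (\<Prod>p\<in>I. ennreal (2 / l))"
    by (intro mult_left_mono prod_mono_ennreal nn_integral_exp_abs_le[OF l]) auto
  also have "\<dots> = ennreal (exp (l * R) * (2 / l) ^ card I)"
    using l by (simp add: ennreal_power ennreal_mult)
  finally show ?thesis .
qed

text \<open>The \<open>L^1\<close> ball has volume at most \<open>(e / (25 * N))^(N * N)\<close>,
  the polytope at least \<open>n^-(N * N + 4 * N)\<close>. The tolerance \<open>1/100\<close> makes
  \<open>e / 25\<close> so small that the ratio of the bases is below \<open>1/2\<close>.\<close>

lemma one_step_near_prob_le:
  assumes N: "1 \<le> N"
  shows "measure (uniform_birkhoff N) {c \<in> space (corner_lborel N).
      \<forall>i\<le>N. 1/2 * (\<Sum>j\<le>N. \<bar>1 / real (Suc N) - fill N c i j\<bar>) \<le> 1/100}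
    \<le> (1/2) ^ (N * N) * real (Suc N) ^ (4 * N)" (is "measure _ ?S \<le> _")
proof -
  let ?M = "corner_lborel N" and ?I = "{..<N} \<times> {..<N}"
  define n where "n = real (Suc N)"
  have n: "1 \<le> n" "n \<le> 2 * N" using N by (auto simp: n_def)
  have S[measurable]: "?S \<in> sets ?M" by measurable
  define A where "A = birkhoff N \<inter> ?S"
  have A[measurable]: "A \<in> sets ?M" unfolding A_def by measurable
  have R: "(\<Sum>p\<in>?I. \<bar>c p - 1 / n\<bar>) \<le> N / 50" if "c \<in> A" for c
  proof -
    have "(\<Sum>j<N. \<bar>c (i, j) - 1 / n\<bar>) \<le> 1 / 50" if i: "i < N" for i
    proof -
      have "(\<Sum>j<N. \<bar>c (i, j) - 1 / n\<bar>) = (\<Sum>j<N. \<bar>1 / n - fill N c i j\<bar>)"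
        using i by (intro sum.cong) (auto simp: fill_def)
      also have "\<dots> \<le> (\<Sum>j\<le>N. \<bar>1 / n - fill N c i j\<bar>)" by (intro sum_mono2) auto
      also have "\<dots> \<le> 1 / 50" using \<open>c \<in> A\<close> i by (auto simp: A_def n_def dest!: spec[of _ i])
      finally show ?thesis .
    qed
    then have "(\<Sum>i<N. \<Sum>j<N. \<bar>c (i, j) - 1 / n\<bar>) \<le> (\<Sum>i<N. 1 / 50)" by (intro sum_mono) auto
    then show ?thesis by (simp add: sum.cartesian_product case_prod_unfold)
  qed
  \<comment> \<open>\<open>l = 50 * N\<close> is the minimizer \<open>card I / R\<close> of the
    Chernoff bound at \<open>R = N / 50\<close>, which stands for \<open>N\<close> rows of
    \<open>L^1\<close> deviation \<open>1 / 50\<close> each.\<close>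
  have "emeasure ?M A \<le> ennreal (exp (50 * N * (N / 50)) * (2 / (50 * N)) ^ card ?I)"
    unfolding corner_lborel_def using N A R
    by (intro emeasure_L1_ball_le[where a = "1 / n"]) (auto simp: corner_lborel_def)
  then have a: "measure ?M A \<le> exp (50 * N * (N / 50)) * (2 / (50 * N)) ^ card ?I"
    unfolding measure_def by (intro enn2real_leI) auto
  also have "exp (50 * N * (N / 50)) * (2 / (50 * N)) ^ card ?I = (exp 1 * (2 / (50 * N))) ^ (N * N)"
  proof -
    have "exp (50 * N * (N / 50)) = exp 1 ^ (N * N)"
      using exp_of_nat_mult[of "N * N" "1 :: real"] by simp
    then show ?thesis by (simp only: card_cartesian_product card_lessThan power_mult_distrib)
  qed
  also have "\<dots> \<le> (3 * (2 / (50 * N))) ^ (N * N)"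
    by (intro power_mono mult_right_mono exp_le) auto
  finally have a: "measure ?M A \<le> (3 * (2 / (50 * N))) ^ (N * N)" .
  have "emeasure ?M (birkhoff N) = ennreal (measure ?M (birkhoff N))"
    using emeasure_birkhoff_finite[of N] by (intro emeasure_eq_ennreal_measure) auto
  then have v: "(1 / n) ^ (N * N) \<le> n ^ (4 * N) * measure ?M (birkhoff N)"
    using emeasure_birkhoff_ge[of N] by (simp add: ennreal_mult[symmetric] n_def del: of_nat_Suc)
  then have v0: "0 < measure ?M (birkhoff N)"
    using n by (smt (verit) zero_less_power mult_nonneg_nonpos divide_pos_pos measure_nonneg mult_eq_0_iff)
  have "measure (uniform_birkhoff N) ?S = measure ?M A / measure ?M (birkhoff N)"
    unfolding uniform_birkhoff_def A_def
    by (rule measure_uniform_measure[OF emeasure_birkhoff_nonzero emeasure_birkhoff_finite S])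
  also have "\<dots> \<le> (1/2) ^ (N * N) * n ^ (4 * N)"
  proof -
    \<comment> \<open>The base satisfies \<open>6 / (50 * N) <= 1 / (2 * n)\<close> because
      \<open>n <= 2 * N\<close>.\<close>
    have "measure ?M A \<le> ((1/2) * (1 / n)) ^ (N * N)"
      using a N n by (elim order_trans) (intro power_mono; simp add: field_simps)
    also have "\<dots> = (1/2) ^ (N * N) * (1 / n) ^ (N * N)" by (rule power_mult_distrib)
    also have "\<dots> \<le> (1/2) ^ (N * N) * (n ^ (4 * N) * measure ?M (birkhoff N))"
      by (intro mult_left_mono v) simp
    finally show ?thesis using v0 by (simp add: pos_divide_le_eq mult.assoc)
  qed
  finally show ?thesis by (simp add: n_def)
qed

section \<open>Transfer to random doubly stochastic matrices\<close>

lemma fill_corner: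
  assumes A: "doubly_stochastic (Suc N) A" and "i \<le> N" "j \<le> N"
  shows "fill N (corner (Suc N) A) i j = A $$ (i, j)"
proof -
  have "fill N (corner (Suc N) A) = (\<lambda>i j. if i \<le> N \<and> j \<le> N then A $$ (i, j) else 0)"
    by (rule fill_unique)
      (use A in \<open>auto simp: doubly_stochastic_def corner_def corner_index_Suc lessThan_Suc_atMost\<close>)
  then show ?thesis using assms by simp
qed

lemma corner_in_birkhoff:
  assumes "doubly_stochastic (Suc N) A"
  shows "corner (Suc N) A \<in> birkhoff N"
proof -
  have "0 \<le> A $$ (i, j)" if "i \<le> N" "j \<le> N" for i j
    using assms that by (simp add: doubly_stochastic_def)
  moreover have "corner (Suc N) A \<in> space (corner_lborel N)"
    by (simp add: corner_lborel_def space_PiM corner_def corner_index_Suc)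
  ultimately show ?thesis by (simp add: birkhoff_def fill_corner[OF assms])
qed

lemma corner_image_doubly_stochastic: "corner (Suc N) ` {A. doubly_stochastic (Suc N) A} = birkhoff N"
proof (intro equalityI subsetI)
  fix c assume c: "c \<in> birkhoff N"
  define A where "A = mat (Suc N) (Suc N) (\<lambda>(i, j). fill N c i j)"
  have "doubly_stochastic (Suc N) A"
    using birkhoff_nonneg[OF c] fill_row_sum fill_col_sum
    by (auto simp: doubly_stochastic_def A_def lessThan_Suc_atMost less_Suc_eq_le simp del: sum.lessThan_Suc sum.atMost_Suc)
  moreover have "corner (Suc N) A = c"
  proof
    fix p show "corner (Suc N) A p = c p"
      using c by (cases p)
        (auto simp: corner_def corner_index_Suc A_def fill_def birkhoff_def corner_lborel_def space_PiM PiE_def extensional_def)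
  qed
  ultimately show "c \<in> corner (Suc N) ` {A. doubly_stochastic (Suc N) A}" by blast
qed (auto intro: corner_in_birkhoff)

text \<open>Measurability is given for the corner of \<open>X\<close> only, so an event about
  \<open>X\<close> is rewritten through \<open>fill\<close> as an event about corners. The rewriting
  has to hold at doubly stochastic matrices only, as \<open>X\<close> takes no other values on
  \<open>space M\<close>.\<close>

lemma prob_uniform_doubly_stochastic:
  assumes X: "uniform_doubly_stochastic (Suc N) M X"
    and S: "{c \<in> space (corner_lborel N). P (fill N c)} \<in> sets (corner_lborel N)"
    and Q: "\<And>A. doubly_stochastic (Suc N) A \<Longrightarrow> Q A \<longleftrightarrow> P (fill N (corner (Suc N) A))"
  shows "\<P>(\<omega> in M. Q (X \<omega>)) = measure (uniform_birkhoff N) {c \<in> space (corner_lborel N). P (fill N c)}"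
proof -
  let ?c = "\<lambda>\<omega>. corner (Suc N) (X \<omega>)"
  have ds: "\<And>\<omega>. \<omega> \<in> space M \<Longrightarrow> doubly_stochastic (Suc N) (X \<omega>)"
    and m: "?c \<in> measurable M (corner_lborel N)"
    and d: "distr M (corner_lborel N) ?c = uniform_birkhoff N"
    using X by (auto simp: uniform_doubly_stochastic_def corner_image_doubly_stochastic uniform_birkhoff_def)
  have "measure (uniform_birkhoff N) {c \<in> space (corner_lborel N). P (fill N c)}
      = measure M (?c -` {c \<in> space (corner_lborel N). P (fill N c)} \<inter> space M)"
    unfolding d[symmetric] by (rule measure_distr[OF m S])
  also have "?c -` {c \<in> space (corner_lborel N). P (fill N c)} \<inter> space M = {\<omega> \<in> space M. Q (X \<omega>)}"
    using measurable_space[OF m] Q ds by auto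
  finally show ?thesis by simp
qed

section \<open>Total variation distances and the mixing time\<close>

lemma tv_from_uniform_gt_iff:
  "\<epsilon> < tv_from_uniform (Suc N) A t \<longleftrightarrow>
    (\<exists>i\<le>N. \<epsilon> < 1/2 * (\<Sum>j\<le>N. \<bar>1 / real (Suc N) - (A ^\<^sub>m t) $$ (i, j)\<bar>))"
  unfolding tv_from_uniform_def
  by (subst Max_gr_iff) (auto simp: lessThan_Suc_atMost simp del: sum.lessThan_Suc sum.atMost_Suc of_nat_Suc)

lemma tv_from_uniform_le_iff:
  "tv_from_uniform (Suc N) A t \<le> \<epsilon> \<longleftrightarrow>
    (\<forall>i\<le>N. 1/2 * (\<Sum>j\<le>N. \<bar>1 / real (Suc N) - (A ^\<^sub>m t) $$ (i, j)\<bar>) \<le> \<epsilon>)"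
  using tv_from_uniform_gt_iff[of \<epsilon> N A t] by (meson linorder_not_less)

lemma tv_two_steps_gt_iff:
  assumes A: "doubly_stochastic (Suc N) A"
  shows "\<epsilon> < tv_from_uniform (Suc N) A 2 \<longleftrightarrow> (\<exists>i\<le>N. \<epsilon> < 1/2 * (\<Sum>j\<le>N. \<bar>1 / real (Suc N) -
    (\<Sum>k\<le>N. fill N (corner (Suc N) A) i k * fill N (corner (Suc N) A) k j)\<bar>))"
proof -
  have c: "A \<in> carrier_mat (Suc N) (Suc N)" using A by (simp add: doubly_stochastic_def)
  have "(A ^\<^sub>m 2) $$ (i, j) = (\<Sum>k\<le>N. fill N (corner (Suc N) A) i k * fill N (corner (Suc N) A) k j)"
    if "i \<le> N" "j \<le> N" for i j
    using that c by (simp add: numeral_2_eq_2 scalar_prod_def fill_corner[OF A] atLeast0LessThan lessThan_Suc_atMost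
      del: sum.lessThan_Suc sum.atMost_Suc sum.op_ivl_Suc)
  then have "(\<Sum>j\<le>N. \<bar>1 / real (Suc N) - (A ^\<^sub>m 2) $$ (i, j)\<bar>) = (\<Sum>j\<le>N. \<bar>1 / real (Suc N) -
      (\<Sum>k\<le>N. fill N (corner (Suc N) A) i k * fill N (corner (Suc N) A) k j)\<bar>)" if "i \<le> N" for i
    using that by (intro sum.cong) auto
  then show ?thesis
    unfolding tv_from_uniform_gt_iff by (intro ex_cong1 conj_cong refl) (simp only:)
qed

lemma tv_one_step_le_iff:
  assumes A: "doubly_stochastic (Suc N) A"
  shows "tv_from_uniform (Suc N) A 1 \<le> \<epsilon> \<longleftrightarrow> (\<forall>i\<le>N. 1/2 * (\<Sum>j\<le>N. \<bar>1 / real (Suc N) -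
    fill N (corner (Suc N) A) i j\<bar>) \<le> \<epsilon>)"
proof -
  have c: "A \<in> carrier_mat (Suc N) (Suc N)" using A by (simp add: doubly_stochastic_def)
  then have "A ^\<^sub>m 1 = A" by simp
  then have "(\<Sum>j\<le>N. \<bar>1 / real (Suc N) - (A ^\<^sub>m 1) $$ (i, j)\<bar>) =
      (\<Sum>j\<le>N. \<bar>1 / real (Suc N) - fill N (corner (Suc N) A) i j\<bar>)" if "i \<le> N" for i
    using that by (intro sum.cong) (auto simp: fill_corner[OF A])
  then show ?thesis
    unfolding tv_from_uniform_le_iff by (intro all_cong1 imp_cong refl) (simp only:)
qed

text \<open>One diagonal entry of the identity alone is off by \<open>1 - 1 / (N + 1)\<close>, at
  least \<open>1/2\<close>, and the factor \<open>1/2\<close> of the distance leaves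
  \<open>1/4\<close>.\<close>

lemma tv_zero_steps_gt:
  assumes N: "1 \<le> N" and A: "A \<in> carrier_mat (Suc N) (Suc N)" and \<epsilon>: "\<epsilon> < 1/4"
  shows "\<epsilon> < tv_from_uniform (Suc N) A 0"
proof -
  have "1/2 \<le> \<bar>1 / real (Suc N) - (A ^\<^sub>m 0) $$ (0, 0)\<bar>"
    using A N by (simp add: field_simps)
  also have "\<dots> \<le> (\<Sum>j\<le>N. \<bar>1 / real (Suc N) - (A ^\<^sub>m 0) $$ (0, j)\<bar>)"
    by (rule member_le_sum) auto
  finally have "\<epsilon> < 1/2 * (\<Sum>j\<le>N. \<bar>1 / real (Suc N) - (A ^\<^sub>m 0) $$ (0, j)\<bar>)" using \<epsilon> by linarith
  then show ?thesis unfolding tv_from_uniform_gt_iff by blast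
qed

text \<open>A nonempty infimum in \<open>enat\<close> is attained and an empty one is infinite, so
  the value \<open>2\<close> means that time \<open>2\<close> is the first to reach
  \<open>\<epsilon>\<close>. No monotonicity of the distance in \<open>t\<close> enters.\<close>

lemma mixing_time_eq_2_iff:
  "mixing_time n A \<epsilon> = 2 \<longleftrightarrow>
    tv_from_uniform n A 2 \<le> \<epsilon> \<and> \<epsilon> < tv_from_uniform n A 1 \<and> \<epsilon> < tv_from_uniform n A 0"
proof -
  let ?T = "{t. tv_from_uniform n A t \<le> \<epsilon>}"
  have two: "(2 :: enat) = enat 2" by (simp add: numeral_eq_enat)
  show ?thesis
  proof
    assume m: "mixing_time n A \<epsilon> = 2"
    have ne: "enat ` ?T \<noteq> {}"
    proof
      assume "enat ` ?T = {}"
      then have "mixing_time n A \<epsilon> = Inf {}" by (simp only: mixing_time_def)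
      then show False using m by (simp add: two top_enat_def)
    qed
    have "mixing_time n A \<epsilon> \<in> enat ` ?T"
      unfolding mixing_time_def using ne by (simp add: Inf_enat_def) (metis (mono_tags, lifting) LeastI ne ex_in_conv imageI mem_Collect_eq)
    then have "tv_from_uniform n A 2 \<le> \<epsilon>" using m by (auto simp: two)
    moreover have "\<epsilon> < tv_from_uniform n A t" if "t < 2" for t
    proof (rule ccontr)
      assume "\<not> \<epsilon> < tv_from_uniform n A t"
      then have "mixing_time n A \<epsilon> \<le> enat t" unfolding mixing_time_def by (intro INF_lower) auto
      then show False using m that by (simp add: two)
    qed
    ultimately show "tv_from_uniform n A 2 \<le> \<epsilon> \<and> \<epsilon> < tv_from_uniform n A 1 \<and> \<epsilon> < tv_from_uniform n A 0" by simp
  next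
    assume tv: "tv_from_uniform n A 2 \<le> \<epsilon> \<and> \<epsilon> < tv_from_uniform n A 1 \<and> \<epsilon> < tv_from_uniform n A 0"
    show "mixing_time n A \<epsilon> = 2"
      unfolding mixing_time_def two
    proof (rule antisym)
      show "(INF t\<in>?T. enat t) \<le> enat 2" using tv by (intro INF_lower) auto
      show "enat 2 \<le> (INF t\<in>?T. enat t)"
      proof (intro INF_greatest)
        fix t assume t: "t \<in> ?T"
        have "t \<noteq> 0" using t tv by (intro notI) simp
        moreover have "t \<noteq> 1" using t tv by (intro notI) simp
        ultimately show "enat 2 \<le> enat t" by simp
      qed
    qed
  qed
qed

text \<open>With \<open>N powr (2/5)\<close> for \<open>K\<close>, the two terms are of order
  \<open>n^(-2/5)\<close> and \<open>n^(-1/5)\<close>.\<close>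

lemma two_step_bound_tendsto_0:
  assumes "0 < \<epsilon>"
  shows "(\<lambda>N. (real (Suc N))\<^sup>2 * (2 ^ 54 / real N ^ 6 / ((real N powr (2/5)) / real (Suc N)) ^ 6)
      + (real (Suc N) / real (N - 1) + 2 * real (Suc N) ^ 3 * (2 ^ 28 / real N ^ 4) - 1) / (16 * \<epsilon> ^ 4 / (real N powr (2/5))\<^sup>2))
    \<longlonglongrightarrow> 0"
  using assms by real_asymp

text \<open>The expression is an \<open>N\<close>-th power whose base
  \<open>(1/2) ^ N * (N + 1) ^ 4\<close> tends to \<open>0\<close>; this absorbs the loss in the
  volume bound.\<close>

lemma one_step_bound_tendsto_0: "(\<lambda>N. (1/2 :: real) ^ (N * N) * real (Suc N) ^ (4 * N)) \<longlonglongrightarrow> 0"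
proof (rule tendsto_sandwich[where f = "\<lambda>_. 0" and h = "\<lambda>N. (1/2) ^ N"])
  have "(\<lambda>N. (1/2 :: real) ^ N * real (Suc N) ^ 4) \<longlonglongrightarrow> 0" by real_asymp
  then have "\<forall>\<^sub>F N in sequentially. (1/2 :: real) ^ N * real (Suc N) ^ 4 < 1/2"
    by (rule order_tendstoD) simp
  then show "\<forall>\<^sub>F N in sequentially. (1/2 :: real) ^ (N * N) * real (Suc N) ^ (4 * N) \<le> (1/2) ^ N"
  proof eventually_elim
    case (elim N)
    have "(1/2 :: real) ^ (N * N) * real (Suc N) ^ (4 * N) = ((1/2) ^ N * real (Suc N) ^ 4) ^ N"
      by (simp only: power_mult_distrib power_mult)
    also have "\<dots> \<le> (1/2) ^ N" using elim by (intro power_mono) auto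
    finally show ?case .
  qed
  show "(\<lambda>N. (1/2 :: real) ^ N) \<longlonglongrightarrow> 0" by real_asymp
qed auto

theorem theorem5:
  fixes M :: "nat \<Rightarrow> 'a measure" and X :: "nat \<Rightarrow> 'a \<Rightarrow> real mat"
  assumes "\<And>n. 1 \<le> n \<Longrightarrow> uniform_doubly_stochastic n (M n) (X n)"
  shows "(\<forall>\<epsilon>>0. (\<lambda>n. \<P>(\<omega> in M n. tv_from_uniform n (X n \<omega>) 2 > \<epsilon>)) \<longlonglongrightarrow> 0) \<and>
    (\<exists>\<epsilon>\<^sub>0>0. \<forall>\<epsilon>. 0 < \<epsilon> \<and> \<epsilon> \<le> \<epsilon>\<^sub>0 \<longrightarrow>
       (\<lambda>n. \<P>(\<omega> in M n. mixing_time n (X n \<omega>) \<epsilon> = 2)) \<longlonglongrightarrow> 1)"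
proof -
  have X: "uniform_doubly_stochastic (Suc N) (M (Suc N)) (X (Suc N))" for N
    by (rule assms) simp
  define far where "far \<epsilon> N Y \<longleftrightarrow> (\<exists>i\<le>N. \<epsilon> < 1/2 * (\<Sum>j\<le>N. \<bar>1 / real (Suc N) - (\<Sum>k\<le>N. Y i k * Y k j)\<bar>))"
    for \<epsilon> N and Y :: "nat \<Rightarrow> nat \<Rightarrow> real"
  define near where "near \<epsilon> N Y \<longleftrightarrow> (\<forall>i\<le>N. 1/2 * (\<Sum>j\<le>N. \<bar>1 / real (Suc N) - Y i j\<bar>) \<le> \<epsilon>)"
    for \<epsilon> N and Y :: "nat \<Rightarrow> nat \<Rightarrow> real"
  let ?U = uniform_birkhoff and ?S = "\<lambda>N P. {c \<in> space (corner_lborel N). P (fill N c)}"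
  have sets: "?S N (far \<epsilon> N) \<in> sets (corner_lborel N)" "?S N (near \<epsilon> N) \<in> sets (corner_lborel N)" for \<epsilon> N
    unfolding far_def near_def by measurable
  have far: "(\<lambda>N. measure (?U N) (?S N (far \<epsilon> N))) \<longlonglongrightarrow> 0" if "0 < \<epsilon>" for \<epsilon>
    unfolding far_def
    by (rule tendsto_sandwich[OF _ _ tendsto_const two_step_bound_tendsto_0[OF that]], simp)
      (rule eventually_sequentiallyI[of 2], rule two_step_far_prob_le, use that in auto)
  have "(\<lambda>N. measure (?U N) (?S N (near (1/100) N))) \<longlonglongrightarrow> 0"
    unfolding near_def
    by (rule tendsto_sandwich[OF _ _ tendsto_const one_step_bound_tendsto_0], simp)
      (rule eventually_sequentiallyI[of 1], rule one_step_near_prob_le)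
  \<comment> \<open>A smaller tolerance shrinks the event, so the estimate at \<open>1/100\<close>
    serves all thresholds below it.\<close>
  then have near: "(\<lambda>N. measure (?U N) (?S N (near \<epsilon> N))) \<longlonglongrightarrow> 0" if "\<epsilon> \<le> 1/100" for \<epsilon>
  proof (rule tendsto_sandwich[rotated 3])
    show "\<forall>\<^sub>F N in sequentially. measure (?U N) (?S N (near \<epsilon> N)) \<le> measure (?U N) (?S N (near (1/100) N))"
      using that sets
      by (intro always_eventually allI uniform_birkhoff.finite_measure_mono) (auto simp: near_def intro: order_trans)
  qed auto
  have "(\<lambda>n. \<P>(\<omega> in M n. tv_from_uniform n (X n \<omega>) 2 > \<epsilon>)) \<longlonglongrightarrow> 0" if "0 < \<epsilon>" for \<epsilon>
  \<comment> \<open>The shift to \<open>n = N + 1\<close> matches the size of the matrices that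
    \<open>fill N\<close> produces.\<close>
  proof (rule LIMSEQ_imp_Suc)
    have "\<P>(\<omega> in M (Suc N). tv_from_uniform (Suc N) (X (Suc N) \<omega>) 2 > \<epsilon>) = measure (?U N) (?S N (far \<epsilon> N))" for N
      by (rule prob_uniform_doubly_stochastic[OF X sets(1)]) (simp only: far_def tv_two_steps_gt_iff)
    then show "(\<lambda>N. \<P>(\<omega> in M (Suc N). tv_from_uniform (Suc N) (X (Suc N) \<omega>) 2 > \<epsilon>)) \<longlonglongrightarrow> 0"
      using far[OF that] by simp
  qed
  moreover have "(\<lambda>n. \<P>(\<omega> in M n. mixing_time n (X n \<omega>) \<epsilon> = 2)) \<longlonglongrightarrow> 1" if \<epsilon>: "0 < \<epsilon>" "\<epsilon> \<le> 1/100" for \<epsilon>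
  proof (rule LIMSEQ_imp_Suc)
    let ?p = "\<lambda>N. \<P>(\<omega> in M (Suc N). mixing_time (Suc N) (X (Suc N) \<omega>) \<epsilon> = 2)"
    have ge: "1 - (measure (?U N) (?S N (far \<epsilon> N)) + measure (?U N) (?S N (near \<epsilon> N))) \<le> ?p N" if N: "1 \<le> N" for N
    proof -
      \<comment> \<open>The mixing time is \<open>2\<close> exactly off two bad events: far after
        two steps, or near after one. Time \<open>0\<close> never interferes, as
        \<open>\<epsilon>\<close> is below \<open>1/4\<close>.\<close>
      let ?B = "?S N (far \<epsilon> N) \<union> ?S N (near \<epsilon> N)" and ?P = "\<lambda>Y. \<not> far \<epsilon> N Y \<and> \<not> near \<epsilon> N Y"
      have S: "?S N ?P = space (?U N) - ?B" by auto
      have "?p N = measure (?U N) (?S N ?P)"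
      proof (rule prob_uniform_doubly_stochastic[OF X])
        show "?S N ?P \<in> sets (corner_lborel N)" unfolding S using sets by auto
        fix A assume A: "doubly_stochastic (Suc N) A"
        then have "\<epsilon> < tv_from_uniform (Suc N) A 0"
          using \<epsilon> N by (intro tv_zero_steps_gt) (auto simp: doubly_stochastic_def)
        then show "mixing_time (Suc N) A \<epsilon> = 2 \<longleftrightarrow> ?P (fill N (corner (Suc N) A))"
          unfolding mixing_time_eq_2_iff far_def near_def tv_two_steps_gt_iff[OF A, symmetric] tv_one_step_le_iff[OF A, symmetric]
          by auto
      qed
      also have "\<dots> = 1 - measure (?U N) ?B"
        unfolding S using sets by (intro uniform_birkhoff.prob_compl) auto
      finally have "?p N = 1 - measure (?U N) ?B" .
      moreover have "measure (?U N) ?B \<le> measure (?U N) (?S N (far \<epsilon> N)) + measure (?U N) (?S N (near \<epsilon> N))"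
        using sets by (intro measure_Un_le) auto
      ultimately show ?thesis by linarith
    qed
    show "?p \<longlonglongrightarrow> 1"
    proof (rule tendsto_sandwich)
      show "\<forall>\<^sub>F N in sequentially. 1 - (measure (?U N) (?S N (far \<epsilon> N)) + measure (?U N) (?S N (near \<epsilon> N))) \<le> ?p N"
        using ge by (rule eventually_sequentiallyI)
      have "prob_space (M (Suc N))" for N using X by (simp add: uniform_doubly_stochastic_def)
      then show "\<forall>\<^sub>F N in sequentially. ?p N \<le> 1"
        by (intro always_eventually allI prob_space.prob_le_1)
      show "(\<lambda>N. 1 - (measure (?U N) (?S N (far \<epsilon> N)) + measure (?U N) (?S N (near \<epsilon> N)))) \<longlonglongrightarrow> 1"
        using tendsto_diff[OF tendsto_const[of 1] tendsto_add[OF far[OF \<epsilon>(1)] near[OF \<epsilon>(2)]]] by simp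
    qed simp
  qed
  ultimately show ?thesis by (intro conjI allI impI exI[of _ "1/100"]) auto
qed

end
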